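(* Let $(A_n)_{n\ge1}$ be a strictly stationary, ergodic process of random $p\times p$ nonnegative column-allowable matrices that is weakly sequentially primitive and satisfies $\mathbb E\log^+\|A_1\|<\infty$. Let $\lambda_1\ge\lambda_2$ be its first and second largest Lyapunov exponents, let $M_n=A_nA_{n-1}\cdots A_1$, assume $\lambda_1-\lambda_2>0$, and assume that for any pair of row indices $i,j$ and any column index $k$ the process $M_n^{ik}/M_n^{jk}$ is weakly subexponential. Take an arbitrary vector of initial values $x\in\mathbb R^p$ and a nonnegative vector of initial weights $w\in\mathbb R^p_+$ such that $w\neq0$. Then ratio consensus takes place, and an explicit upper bound for the rate of convergence can be given as follows: for all $i=1,\dots,p$, almost surely $$\limsup_{\substack{n\to\infty\\ e_i^\top M_n\neq 0}}\frac1n\log\left|\frac{e_i^\top M_nx}{e_i^\top M_nw}-\frac{v^1x}{v^1w}\right|\le-(\lambda_1-\lambda_2)$$ for some positive random (row) vector $v^1\in\mathbb R^p_+$.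
   Context: $\mathbb R^p_+$ denotes the set of nonnegative, nonzero vectors of $\mathbb R^p$; $e_i$ is the $i$th unit vector; $\mathbf 1=(1,\dots,1)^\top\in\mathbb R^p$; $M_n^{ik}$ is the $(i,k)$ entry of $M_n$; $\log0=-\infty$, and a limsup over only finitely many indices $n$ is $-\infty$. Ratio consensus: starting from $x_0=x$ and $w_0=w$, the value and weight vectors are updated by $x_n=A_nx_{n-1}$, $w_n=A_nw_{n-1}$, so $x_n=M_nx$ and $w_n=M_nw$. Ratio consensus is said to hold (take place) if for each node (coordinate) $i\in\{1,\dots,p\}$ the ratio $x_n^i/w_n^i=\frac{e_i^\top M_nx}{e_i^\top M_nw}$ converges, as $n\to\infty$, to $\frac{\mathbf 1^\top x_0}{\mathbf 1^\top w_0}$ almost surely. A nonnegative matrix is column-allowable if each of its columns contains a strictly positive entry. A strictly stationary process of nonnegative column-allowable matrices $(A_n)_{n\ge1}$ is weakly (forward) sequentially primitive if there is an almost surely finite stopping time $\tau$ such that each row of $M_\tau=A_\tau A_{\tau-1}\cdots A_1$ is either strictly positive or zero. A process $(\xi_n)$ (possibly taking the value $\infty$) is weakly subexponential if for any $\varepsilon>0$, almost surely, for all $n$ with finitely many exceptions, $|\xi_n|\le e^{\varepsilon n}$ or $\xi_n=\infty$. For ratios of entries, $a/0=\infty$ for $a>0$, and indices $n$ with $0/0$ are disregarded. Lyapunov exponents: for a realization of the sequence and $x\in\mathbb R^p$ put $\lambda(x)=\limsup_n\frac1n\log|A_n\cdots A_1x|$ and $L_\mu=\{x:\lambda(x)\le\mu\}$,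 a linear subspace. There are finitely many values $\mu_1>\dots>\mu_q\ge-\infty$ with $\mathbb R^p=L_{\mu_1}\supsetneq\dots\supsetneq L_{\mu_q}\supsetneq\{0\}=:L_{\mu_{q+1}}$ and $\lambda(x)=\mu_r$ on $L_{\mu_r}\setminus L_{\mu_{r+1}}$. The full spectrum $\lambda_1\ge\lambda_2\ge\dots\ge\lambda_p\ge-\infty$ lists each $\mu_r$ with multiplicity $\dim L_{\mu_r}-\dim L_{\mu_{r+1}}$. Under stationarity, ergodicity and $\mathbb E\log^+\|A_1\|<\infty$, the exponents are almost surely deterministic (Oseledec).
   Formalization: Ratio consensus is stated with limit v¹x/v¹w instead of 1ᵀx/1ᵀw, along indices n with e_iᵀM_n≠0 (otherwise the ratio is 0/0): with limit 1ᵀx/1ᵀw the claim fails, e.g. for the constant sequence A_n=[[2,1],[4,2]]. *)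

theory Defs
  imports "HOL-Probability.Probability"
begin

section \<open>Matrices and forward products\<close>

definition nonneg_matrix :: "real^'p^'p \<Rightarrow> bool" where
  "nonneg_matrix B \<longleftrightarrow> (\<forall>i k. 0 \<le> B $ i $ k)"

definition column_allowable :: "real^'p^'p \<Rightarrow> bool" where
  "column_allowable B \<longleftrightarrow> (\<forall>k. \<exists>i. 0 < B $ i $ k)"

text \<open>A sequence of matrices is indexed from \<open>1\<close>; the entry at index \<open>0\<close> is never used.
  Thus \<open>fwd_prod B n = B n ** \<dots> ** B 1\<close>.\<close>

primrec fwd_prod :: "(nat \<Rightarrow> real^'p^'p) \<Rightarrow> nat \<Rightarrow> real^'p^'p" where
  "fwd_prod B 0 = mat 1"
| "fwd_prod B (Suc n) = B (Suc n) ** fwd_prod B n"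

definition realization :: "(nat \<Rightarrow> 'w \<Rightarrow> 'a) \<Rightarrow> 'w \<Rightarrow> nat \<Rightarrow> 'a" where
  "realization A \<omega> = (\<lambda>n. A n \<omega>)"


section \<open>Stationarity and ergodicity of a process indexed by \<open>n \<ge> 1\<close>\<close>

abbreviation seq_space :: "(nat \<Rightarrow> 'a::topological_space) measure" where
  "seq_space \<equiv> Pi\<^sub>M UNIV (\<lambda>_. borel)"

definition strictly_stationary :: "'w measure \<Rightarrow> (nat \<Rightarrow> 'w \<Rightarrow> 'a::topological_space) \<Rightarrow> bool" where
  "strictly_stationary P A \<longleftrightarrow>
     (\<forall>k. distr P seq_space (\<lambda>\<omega> n. A (Suc (n + k)) \<omega>)
        = distr P seq_space (\<lambda>\<omega> n. A (Suc n) \<omega>))"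

text \<open>Ergodicity of the shift with respect to the law of \<open>(A\<^sub>1, A\<^sub>2, \<dots>)\<close>.\<close>

definition ergodic_process :: "'w measure \<Rightarrow> (nat \<Rightarrow> 'w \<Rightarrow> 'a::topological_space) \<Rightarrow> bool" where
  "ergodic_process P A \<longleftrightarrow>
     (\<forall>S \<in> sets seq_space. (\<lambda>s n. s (Suc n)) -` S = S \<longrightarrow>
        measure P {\<omega> \<in> space P. (\<lambda>n. A (Suc n) \<omega>) \<in> S} \<in> {0, 1})"


section \<open>Weak sequential primitivity\<close>

definition natural_filtration ::
    "'w measure \<Rightarrow> (nat \<Rightarrow> 'w \<Rightarrow> 'a::topological_space) \<Rightarrow> enat \<Rightarrow> 'w measure" where
  "natural_filtration P A t =
     sigma (space P) {A k -` S \<inter> space P | k S. 1 \<le> k \<and> enat k \<le> t \<and> S \<in> sets borel}"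

text \<open>The stopping time takes values in \<^typ>\<open>enat\<close>, so that it can be infinite on a null set.\<close>

definition weakly_seq_primitive :: "'w measure \<Rightarrow> (nat \<Rightarrow> 'w \<Rightarrow> real^'p^'p) \<Rightarrow> bool" where
  "weakly_seq_primitive P A \<longleftrightarrow>
     (\<exists>\<tau> :: 'w \<Rightarrow> enat. stopping_time (natural_filtration P A) \<tau> \<and>
        (AE \<omega> in P. \<exists>n. \<tau> \<omega> = enat n \<and>
           (\<forall>i. (\<forall>k. 0 < fwd_prod (realization A \<omega>) n $ i $ k) \<or>
                (\<forall>k. fwd_prod (realization A \<omega>) n $ i $ k = 0))))"


section \<open>Weakly subexponential processes\<close>

definition weakly_subexponential :: "'w measure \<Rightarrow> (nat \<Rightarrow> 'w \<Rightarrow> ereal) \<Rightarrow> bool" where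
  "weakly_subexponential P \<xi> \<longleftrightarrow>
     (\<forall>\<epsilon>>0. AE \<omega> in P. \<forall>\<^sub>F n in sequentially.
        \<bar>\<xi> n \<omega>\<bar> \<le> ereal (exp (\<epsilon> * real n)) \<or> \<xi> n \<omega> = \<infinity>)"

text \<open>Division in \<^typ>\<open>ereal\<close> gives \<open>a / 0 = \<infinity>\<close> for \<open>a > 0\<close>. It gives \<open>0 / 0 = 0\<close>, and the value
  \<open>0\<close> always meets the bound above, so the indices with \<open>0 / 0\<close> are in effect disregarded.\<close>

definition entry_ratio ::
    "(nat \<Rightarrow> 'w \<Rightarrow> real^'p^'p) \<Rightarrow> 'p \<Rightarrow> 'p \<Rightarrow> 'p \<Rightarrow> nat \<Rightarrow> 'w \<Rightarrow> ereal" where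
  "entry_ratio A i j k n \<omega> =
     ereal (fwd_prod (realization A \<omega>) n $ i $ k) / ereal (fwd_prod (realization A \<omega>) n $ j $ k)"


section \<open>Lyapunov exponents\<close>

definition log_ereal :: "real \<Rightarrow> ereal" where
  "log_ereal r = (if r = 0 then -\<infinity> else ereal (ln r))"

definition lyap :: "(nat \<Rightarrow> real^'p^'p) \<Rightarrow> real^'p \<Rightarrow> ereal" where
  "lyap B x = limsup (\<lambda>n. ereal (1 / real n) * log_ereal (norm (fwd_prod B n *v x)))"

text \<open>The values \<open>\<mu>\<^sub>1 > \<dots> > \<mu>\<^sub>q\<close> are those of \<^term>\<open>lyap B\<close> on nonzero vectors. For
  \<open>\<mu> = \<mu>\<^sub>r\<close> the subspace \<open>L\<^bsub>\<mu>\<^sub>r\<^sub>+\<^sub>1\<^esub>\<close>, with \<open>L\<^bsub>\<mu>\<^sub>q\<^sub>+\<^sub>1\<^esub> = {0}\<close>, is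
  \<open>insert 0 {x. lyap B x < \<mu>\<^sub>r}\<close>, no value lying strictly between \<open>\<mu>\<^sub>r\<^sub>+\<^sub>1\<close> and \<open>\<mu>\<^sub>r\<close>.\<close>

definition lyap_values :: "(nat \<Rightarrow> real^'p^'p) \<Rightarrow> ereal set" where
  "lyap_values B = lyap B ` (UNIV - {0})"

definition lyap_mult :: "(nat \<Rightarrow> real^'p^'p) \<Rightarrow> ereal \<Rightarrow> nat" where
  "lyap_mult B \<mu> = dim {x. lyap B x \<le> \<mu>} - dim (insert 0 {x. lyap B x < \<mu>})"

definition lyap_spectrum :: "(nat \<Rightarrow> real^'p^'p) \<Rightarrow> ereal list" where
  "lyap_spectrum B =
     concat (map (\<lambda>\<mu>. replicate (lyap_mult B \<mu>) \<mu>) (rev (sorted_list_of_set (lyap_values B))))"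

text \<open>The exponents are numbered from \<open>1\<close>. Beyond the dimension, e.g. for the second exponent when
  the dimension is \<open>1\<close>, the convention is \<open>-\<infinity>\<close>.\<close>

definition lyap_exponent :: "(nat \<Rightarrow> real^'p^'p) \<Rightarrow> nat \<Rightarrow> ereal" where
  "lyap_exponent B k =
     (if k \<le> length (lyap_spectrum B) then lyap_spectrum B ! (k - 1) else -\<infinity>)"

definition has_lyap_exponent ::
    "'w measure \<Rightarrow> (nat \<Rightarrow> 'w \<Rightarrow> real^'p^'p) \<Rightarrow> nat \<Rightarrow> ereal \<Rightarrow> bool" where
  "has_lyap_exponent P A k c \<longleftrightarrow> (AE \<omega> in P. lyap_exponent (realization A \<omega>) k = c)"


section \<open>Ratio consensus\<close>

definition node_ratio ::
    "(nat \<Rightarrow> real^'p^'p) \<Rightarrow> real^'p \<Rightarrow> real^'p \<Rightarrow> 'p \<Rightarrow> nat \<Rightarrow> real" where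
  "node_ratio B x w i n = (fwd_prod B n *v x) $ i / (fwd_prod B n *v w) $ i"

text \<open>\<open>n \<rightarrow> \<infinity>\<close> along the indices for which row \<open>i\<close> of the product is nonzero. If there are only
  finitely many of them, this is the trivial filter \<^term>\<open>bot\<close>: limits are vacuous and
  a \<^const>\<open>Limsup\<close> in \<^typ>\<open>ereal\<close> is \<open>-\<infinity>\<close>.\<close>

definition nonzero_row_indices :: "(nat \<Rightarrow> real^'p^'p) \<Rightarrow> 'p \<Rightarrow> nat filter" where
  "nonzero_row_indices B i = inf sequentially (principal {n. row i (fwd_prod B n) \<noteq> 0})"

text \<open>The common limit \<open>c\<close> is a parameter and may be random. For column-stochastic matrices it is
  \<open>sum x / sum w\<close>, the ratio of the coordinate sums of \<open>x\<close> and \<open>w\<close>, but not for general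
  column-allowable ones.\<close>

definition ratio_consensus ::
    "'w measure \<Rightarrow> (nat \<Rightarrow> 'w \<Rightarrow> real^'p^'p) \<Rightarrow> real^'p \<Rightarrow> real^'p \<Rightarrow> ('w \<Rightarrow> real) \<Rightarrow> bool" where
  "ratio_consensus P A x w c \<longleftrightarrow>
     (\<forall>i. AE \<omega> in P.
        (node_ratio (realization A \<omega>) x w i \<longlongrightarrow> c \<omega>) (nonzero_row_indices (realization A \<omega>) i))"

end

(* The second exponent being strictly smaller, the vectors whose growth rate is below lam1 form
   a hyperplane {x. v . x = 0}, on which the rate is at most lam2.  Weak primitivity makes
   M_n w comparable to M_n for every nonzero w \<ge> 0, so v can be taken positive, and subexponentiality
   of the entry ratios extends the comparison to the single coordinate (M_n w)_i.  With
   y = x - (v . x / v . w) w in the hyperplane, the error is (M_n y)_i / (M_n w)_i, of rate lam2 - lam1,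
   as soon as the rate lam1, defined by a limsup, is known to be a liminf for the norm of M_n.
   That is the lower half of the Furstenberg-Kesten theorem, proved in the manner of Steele. *)
theory Submission
  imports Defs "HOL-Real_Asymp.Real_Asymp"
begin

section \<open>Birkhoff sums of an ergodic system\<close>

text \<open>The error at node i has the i-th coordinate of M_n w in its denominator, so a lower
  bound is needed at every large time, whereas a limsup gives one along a subsequence only. This is
  where ergodic theory enters, in the form of a dichotomy: for each threshold rate the norms are
  almost surely eventually above it, or almost surely eventually at most a slightly larger one. The
  second case is refuted by a vector whose growth rate is lam1. Another obstacle is measurability.
  The normal vector of the hyperplane comes from a dimension count, separately for each realization,
  while one random vector has to serve all \<open>x\<close> and \<open>w\<close>. Scaled to
  coordinate sum 1 it becomes a limit: its k-th coordinate is the limiting share of column k in the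
  sum of all entries of M_n. Lastly, "for every rate, almost surely" has to be turned into "almost
  surely, for every rate" before a single realization can be studied; the bounds are monotone in the
  rate, so countably many rates are enough.\<close>

locale ergodic_system = prob_space M for M :: "'a measure" +
  fixes T :: "'a \<Rightarrow> 'a"
  assumes T_measurable [measurable]: "T \<in> measurable M M"
    and T_invariant: "distr M M T = M"
    and T_ergodic: "\<And>S. S \<in> sets M \<Longrightarrow> T -` S \<inter> space M = S \<Longrightarrow> prob S \<in> {0, 1}"
begin

lemma T_space: "x \<in> space M \<Longrightarrow> T x \<in> space M"
  using measurable_space[OF T_measurable] .

lemma funpow_T_measurable [measurable]: "(T ^^ n) \<in> measurable M M"
  by (induction n) (auto intro: measurable_comp[OF _ T_measurable] simp: id_def[symmetric])

lemma prob_vimage_T: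
  assumes "S \<in> sets M"
  shows "prob (T -` S \<inter> space M) = prob S"
  using measure_distr[OF T_measurable assms] by (simp add: T_invariant)

lemma integral_T:
  fixes f :: "'a \<Rightarrow> real"
  assumes "f \<in> borel_measurable M"
  shows "(\<integral>x. f (T x) \<partial>M) = (\<integral>x. f x \<partial>M)"
  using integral_distr[OF T_measurable assms] by (simp add: T_invariant)

lemma integrable_T:
  fixes f :: "'a \<Rightarrow> real"
  assumes "integrable M f"
  shows "integrable M (\<lambda>x. f (T x))"
  using assms integrable_distr_eq[OF T_measurable, of f] by (simp add: T_invariant)

text \<open>The iterated preimages of E decrease and all have the probability of E. Their
  intersection therefore has it too, and it is exactly invariant, as \<open>T_ergodic\<close>
  demands. For the "infinitely often" sets below only one inclusion is established.\<close>

lemma prob_subinvariant: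
  assumes [measurable]: "E \<in> sets M" and sub: "T -` E \<inter> space M \<subseteq> E"
  shows "prob E \<in> {0, 1}"
proof -
  define D where "D n = (T ^^ n) -` E \<inter> space M" for n
  have D_sets: "D n \<in> sets M" for n
    unfolding D_def by measurable
  have D_Suc: "D (Suc n) = T -` D n \<inter> space M" for n
    unfolding D_def by (auto simp: funpow_Suc_right T_space simp del: funpow.simps)
  have D_0: "D 0 = E"
    using sets.sets_into_space[OF assms(1)] by (auto simp: D_def)
  have prob_D: "prob (D n) = prob E" for n
    by (induction n) (simp_all add: D_0 D_Suc prob_vimage_T D_sets)
  have D_le: "D (Suc n) \<subseteq> D n" for n
  proof (induction n)
    case 0
    then show ?case using sub D_0 D_Suc by auto
  next
    case (Suc n)
    then show ?case using D_Suc[of n] D_Suc[of "Suc n"] by auto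
  qed
  define S where "S = (\<Inter>n. D n)"
  have S_sets: "S \<in> sets M"
    unfolding S_def using D_sets by auto
  have "T -` S \<inter> space M = (\<Inter>n. D (Suc n))"
    unfolding S_def D_Suc by auto
  also have "\<dots> = S"
    unfolding S_def using D_le by fast
  finally have "prob S \<in> {0, 1}"
    by (rule T_ergodic[OF S_sets])
  moreover have "(\<lambda>n. prob (D n)) \<longlonglongrightarrow> prob S"
    unfolding S_def using D_sets D_le
    by (intro finite_Lim_measure_decseq) (auto intro: decseq_SucI)
  then have "prob S = prob E"
    by (simp add: prob_D LIMSEQ_const_iff)
  ultimately show ?thesis by simp
qed

definition birkhoff_sum :: "('a \<Rightarrow> real) \<Rightarrow> nat \<Rightarrow> 'a \<Rightarrow> real" where
  "birkhoff_sum f n x = (\<Sum>k<n. f ((T ^^ k) x))"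

lemma birkhoff_sum_0 [simp]: "birkhoff_sum f 0 x = 0"
  by (simp add: birkhoff_sum_def)

lemma birkhoff_sum_Suc: "birkhoff_sum f (Suc n) x = f x + birkhoff_sum f n (T x)"
  unfolding birkhoff_sum_def
  by (subst sum.lessThan_Suc_shift) (simp add: funpow_Suc_right del: funpow.simps(2))

lemma birkhoff_sum_add:
  "birkhoff_sum f (m + n) x = birkhoff_sum f m x + birkhoff_sum f n ((T ^^ m) x)"
  by (induction m arbitrary: x)
     (simp_all add: birkhoff_sum_Suc funpow_Suc_right del: funpow.simps(2))

lemma birkhoff_sum_nonneg:
  assumes "\<And>x. 0 \<le> f x"
  shows "0 \<le> birkhoff_sum f n x"
  by (simp add: birkhoff_sum_def sum_nonneg assms)

lemma birkhoff_sum_mono: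
  assumes "\<And>x. f x \<le> g x"
  shows "birkhoff_sum f n x \<le> birkhoff_sum g n x"
  by (simp add: birkhoff_sum_def sum_mono assms)

lemma birkhoff_sum_add_const:
  "birkhoff_sum (\<lambda>x. f x + c) n x = birkhoff_sum f n x + real n * c"
  by (simp add: birkhoff_sum_def sum.distrib)

lemma birkhoff_sum_measurable [measurable]:
  assumes [measurable]: "f \<in> borel_measurable M"
  shows "birkhoff_sum f n \<in> borel_measurable M"
  unfolding birkhoff_sum_def by measurable

text \<open>This is the maximum of \<open>birkhoff_sum f k x\<close> over k <= n. The recursive form
  reduces Garsia's inequality to one unfolding.\<close>

primrec max_sum :: "('a \<Rightarrow> real) \<Rightarrow> nat \<Rightarrow> 'a \<Rightarrow> real" where
  "max_sum f 0 x = 0"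
| "max_sum f (Suc n) x = max 0 (f x + max_sum f n (T x))"

lemma max_sum_nonneg: "0 \<le> max_sum f n x"
  by (cases n) auto

lemma max_sum_Suc_ge: "max_sum f n x \<le> max_sum f (Suc n) x"
proof (induction n arbitrary: x)
  case (Suc n)
  have "max_sum f n (T x) \<le> max_sum f (Suc n) (T x)" by (rule Suc)
  then show ?case by (subst (1 2) max_sum.simps) linarith
qed simp

lemma max_sum_mono: "m \<le> n \<Longrightarrow> max_sum f m x \<le> max_sum f n x"
  by (rule lift_Suc_mono_le[of "\<lambda>n. max_sum f n x"]) (rule max_sum_Suc_ge)

lemma birkhoff_sum_le_max_sum: "birkhoff_sum f n x \<le> max_sum f n x"
proof (induction n arbitrary: x)
  case (Suc n)
  from Suc[of "T x"] show ?case by (simp add: birkhoff_sum_Suc)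
qed simp

lemma max_sum_integrable:
  assumes "integrable M f"
  shows "integrable M (max_sum f n)"
proof (induction n)
  case (Suc n)
  have "integrable M (\<lambda>x. max 0 (f x + max_sum f n (T x)))"
    using assms integrable_T[OF Suc] by (intro integrable_max) auto
  then show ?case by simp
next
  case 0
  have "max_sum f 0 = (\<lambda>x. 0)" by auto
  then show ?case by simp
qed

text \<open>Garsia's argument: where the maximum is positive, \<open>f\<close> dominates its decrement along \<open>T\<close>, which
  integrates to \<open>0\<close>.\<close>

lemma integral_nonneg_if_birkhoff_sum_pos:
  assumes f: "integrable M f" and pos: "AE x in M. \<exists>n. 0 < birkhoff_sum f n x"
  shows "0 \<le> (\<integral>x. f x \<partial>M)"
proof -
  define g where "g n x = indicator {x. 0 < max_sum f (Suc n) x} x * f x" for n x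
  have [measurable]: "f \<in> borel_measurable M" using f by auto
  have [measurable]: "max_sum f n \<in> borel_measurable M" for n
    using max_sum_integrable[OF f, of n] by auto
  have g_meas: "g n \<in> borel_measurable M" for n
    unfolding g_def by measurable
  have g_int: "integrable M (g n)" for n
    by (rule Bochner_Integration.integrable_bound[OF f g_meas]) (auto simp: g_def indicator_def)
  have g_ge: "0 \<le> (\<integral>x. g n x \<partial>M)" for n
  proof -
    have int: "integrable M (max_sum f (Suc n))" by (rule max_sum_integrable[OF f])
    have "(\<integral>x. max_sum f (Suc n) x - max_sum f (Suc n) (T x) \<partial>M) \<le> (\<integral>x. g n x \<partial>M)"
    proof (rule integral_mono)
      show "integrable M (\<lambda>x. max_sum f (Suc n) x - max_sum f (Suc n) (T x))"
        using int integrable_T[OF int] by (rule Bochner_Integration.integrable_diff)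
      fix x
      have "max_sum f n (T x) \<le> max_sum f (Suc n) (T x)" by (rule max_sum_Suc_ge)
      moreover have "0 \<le> max_sum f (Suc n) (T x)" by (rule max_sum_nonneg)
      moreover have "max_sum f (Suc n) x = max 0 (f x + max_sum f n (T x))" by simp
      \<comment> \<open>A positive maximum equals \<open>f x + max_sum f n (T x)\<close>, and
        subtracting the larger \<open>max_sum f (Suc n) (T x)\<close> leaves at most
        \<open>f x\<close>. If the maximum is 0, the difference is at most 0.\<close>
      ultimately show "max_sum f (Suc n) x - max_sum f (Suc n) (T x) \<le> g n x"
        unfolding g_def indicator_def by (auto simp del: max_sum.simps)
    qed (rule g_int)
    moreover have "(\<integral>x. max_sum f (Suc n) x - max_sum f (Suc n) (T x) \<partial>M) = 0"
      using integral_T[of "max_sum f (Suc n)"] int integrable_T[OF int]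
      by (subst Bochner_Integration.integral_diff) (auto simp del: max_sum.simps)
    ultimately show ?thesis by simp
  qed
  \<comment> \<open>The sets where \<open>max_sum f (Suc n)\<close> is positive grow with n and, by
    \<open>pos\<close>, exhaust almost the whole space.\<close>
  have "(\<lambda>n. \<integral>x. g n x \<partial>M) \<longlonglongrightarrow> (\<integral>x. f x \<partial>M)"
  proof (rule integral_dominated_convergence[where w = "\<lambda>x. norm (f x)"])
    show "AE x in M. (\<lambda>n. g n x) \<longlonglongrightarrow> f x"
      using pos
    proof (rule AE_mp, intro AE_I2 impI)
      fix x assume "\<exists>n. 0 < birkhoff_sum f n x"
      then obtain n where "0 < birkhoff_sum f n x" by blast
      then have n: "0 < max_sum f n x" using birkhoff_sum_le_max_sum[of f n x] by linarith
      have "\<forall>\<^sub>F m in sequentially. g m x = f x"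
        using eventually_ge_at_top[of n]
      proof eventually_elim
        case (elim m)
        then have "max_sum f n x \<le> max_sum f (Suc m) x" by (intro max_sum_mono) simp
        with n show ?case by (simp add: g_def del: max_sum.simps)
      qed
      then show "(\<lambda>n. g n x) \<longlonglongrightarrow> f x" by (rule tendsto_eventually)
    qed
  qed (use f g_meas in \<open>auto simp: g_def indicator_def\<close>)
  then show ?thesis
    by (rule LIMSEQ_le_const) (use g_ge in auto)
qed

text \<open>The set E, where the upper average is at least c, has probability 0 or 1. Probability 1
  would make some Birkhoff sum of f - d m positive at almost every point, although f - d m has a
  negative integral for large m.\<close>

lemma birkhoff_sum_upper:
  assumes f: "integrable M f" and nonneg: "\<And>x. 0 \<le> f x" and c: "(\<integral>x. f x \<partial>M) < c"
  shows "AE x in M. \<forall>\<^sub>F n in sequentially. birkhoff_sum f n x \<le> real n * c"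
proof -
  have [measurable]: "f \<in> borel_measurable M" using f by auto
  \<comment> \<open>The thresholds increase strictly to c. Passing from T x to x replaces n by n +
    1, and the drop from \<open>d (Suc m)\<close> to \<open>d m\<close> pays for this.\<close>
  define d where "d m = c - 1 / real (Suc m)" for m
  define E where "E = {x \<in> space M. \<forall>m. \<exists>\<^sub>F n in sequentially. real n * d m < birkhoff_sum f n x}"
  have E_sets [measurable]: "E \<in> sets M"
    unfolding E_def frequently_sequentially by measurable
  have "T -` E \<inter> space M \<subseteq> E"
  proof
    fix x assume x: "x \<in> T -` E \<inter> space M"
    have "\<exists>\<^sub>F n in sequentially. real n * d m < birkhoff_sum f n x" for m
    proof -
      have lt: "d m < d (Suc m)"
        unfolding d_def by (simp add: frac_less2)
      have "\<exists>\<^sub>F n in sequentially. real n * d (Suc m) < birkhoff_sum f n (T x)"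
        using x unfolding E_def by auto
      moreover have "\<forall>\<^sub>F n in sequentially. real (Suc n) * d m \<le> real n * d (Suc m)"
        using lt by real_asymp
      ultimately have "\<exists>\<^sub>F n in sequentially. real (Suc n) * d m < birkhoff_sum f (Suc n) x"
      proof (rule frequently_rev_mp[OF _ eventually_mono])
        fix n assume "real (Suc n) * d m \<le> real n * d (Suc m)"
        then show "real n * d (Suc m) < birkhoff_sum f n (T x) \<longrightarrow>
            real (Suc n) * d m < birkhoff_sum f (Suc n) x"
          using nonneg[of x] by (simp add: birkhoff_sum_Suc)
      qed
      then show ?thesis
        unfolding frequently_sequentially by (metis le_Suc_eq)
    qed
    then show "x \<in> E" using x by (simp add: E_def)
  qed
  with E_sets have "prob E \<in> {0, 1}" by (rule prob_subinvariant)
  moreover have "prob E \<noteq> 1"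
  proof
    assume "prob E = 1"
    then have AE_E: "AE x in M. x \<in> E" using E_sets by (simp add: prob_eq_1)
    obtain m where "inverse (real (Suc m)) < c - (\<integral>x. f x \<partial>M)"
      using reals_Archimedean[of "c - (\<integral>x. f x \<partial>M)"] c by auto
    then have m: "(\<integral>x. f x \<partial>M) < d m" by (simp add: d_def inverse_eq_divide)
    have "0 \<le> (\<integral>x. f x + - d m \<partial>M)"
    proof (rule integral_nonneg_if_birkhoff_sum_pos)
      show "AE x in M. \<exists>n. 0 < birkhoff_sum (\<lambda>x. f x + - d m) n x"
        using AE_E
      proof eventually_elim
        case (elim x)
        then have "\<exists>n\<ge>0. real n * d m < birkhoff_sum f n x"
          unfolding E_def frequently_sequentially by blast
        then show ?case unfolding birkhoff_sum_add_const by auto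
      qed
    qed (use f in auto)
    also have "(\<integral>x. f x + - d m \<partial>M) = (\<integral>x. f x \<partial>M) - d m"
      using f by (simp add: prob_space)
    finally show False using m by simp
  qed
  ultimately have "prob E = 0" by simp
  then have "AE x in M. x \<notin> E" using E_sets by (simp add: prob_eq_0)
  then show ?thesis
    using AE_space
  proof eventually_elim
    case (elim x)
    then obtain m where "\<forall>\<^sub>F n in sequentially. birkhoff_sum f n x \<le> real n * d m"
      unfolding E_def by (auto simp: not_frequently not_less)
    then show ?case
    proof eventually_elim
      case (elim n)
      moreover have "real n * d m \<le> real n * c"
        by (intro mult_left_mono) (auto simp: d_def)
      ultimately show ?case by linarith
    qed
  qed
qed

section \<open>Growth rates of submultiplicative cocycles\<close>

text \<open>The block decomposition behind Steele's proof of the subadditive ergodic theorem: outside of the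
  exceptional set \<open>B\<close> an orbit is cut into blocks of length at most \<open>N\<close> on which \<open>h\<close> grows at rate at
  most \<open>b\<close>, on \<open>B\<close> it advances by single steps.\<close>

lemma submultiplicative_block_bound:
  fixes h :: "nat \<Rightarrow> 'a \<Rightarrow> real" and F :: "'a \<Rightarrow> real"
  assumes h_nonneg: "\<And>n x. 0 \<le> h n x"
    and h_submult: "\<And>m n x. h (m + n) x \<le> h m x * h n ((T ^^ m) x)"
    and h_0: "\<And>x. h 0 x \<le> C" and C: "1 \<le> C"
    and h_1: "\<And>x. h 1 x \<le> exp (F x)" and F: "\<And>x. 0 \<le> F x"
    and B: "\<And>x. x \<notin> B \<Longrightarrow> \<exists>n\<in>{1..N}. h n x \<le> exp (real n * b)"
    and L: "\<And>x. x \<notin> B \<Longrightarrow> F x \<le> L" "0 \<le> L"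
  shows "h K x \<le> C * exp (real K * b
    + birkhoff_sum (\<lambda>x. indicator B x * (F x + \<bar>b\<bar>)) K x + real N * (L + \<bar>b\<bar>))"
proof (induction K arbitrary: x rule: less_induct)
  case (less K)
  \<comment> \<open>A point of B is left by a single step of cost F x. The extra \<bar>b\<bar>
    offsets the summand b booked for that step, which may be negative.\<close>
  define \<phi> where "\<phi> x = indicator B x * (F x + \<bar>b\<bar>)" for x
  have \<phi>_nonneg: "0 \<le> \<phi> x" for x
    using F[of x] by (simp add: \<phi>_def)
  have F_le: "F x \<le> \<phi> x + (b + (L + \<bar>b\<bar>))" for x
    using L(2) L(1)[of x] by (cases "x \<in> B") (auto simp: \<phi>_def abs_if)
  define R where "R K x = real K * b + birkhoff_sum \<phi> K x + real N * (L + \<bar>b\<bar>)" for K x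
  have step: "h K x \<le> C * exp (R K x)"
    if n: "n \<in> {1..K}" "h n x \<le> exp (real n * b + birkhoff_sum \<phi> n x)" for n
  proof -
    have "h K x \<le> h n x * h (K - n) ((T ^^ n) x)"
      using h_submult[of n "K - n" x] n by simp
    \<comment> \<open>The constant C is charged to the rest of the orbit only, so it does not
      multiply from block to block.\<close>
    also have "\<dots> \<le> exp (real n * b + birkhoff_sum \<phi> n x) * (C * exp (R (K - n) ((T ^^ n) x)))"
      using n less[of "K - n" "(T ^^ n) x"] h_nonneg
      by (intro mult_mono) (auto simp: R_def \<phi>_def[abs_def])
    also have "\<dots> = C * exp (R K x)"
    proof -
      have "birkhoff_sum \<phi> K x = birkhoff_sum \<phi> n x + birkhoff_sum \<phi> (K - n) ((T ^^ n) x)"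
        using birkhoff_sum_add[of \<phi> n "K - n" x] n by simp
      then have "R K x = (real n * b + birkhoff_sum \<phi> n x) + R (K - n) ((T ^^ n) x)"
        using n by (simp add: R_def of_nat_diff algebra_simps)
      then show ?thesis by (simp add: exp_add)
    qed
    finally show ?thesis .
  qed
  have crude: "h n x \<le> C * exp (birkhoff_sum F n x)" for n x
  proof (induction n arbitrary: x)
    case (Suc n)
    have "h (Suc n) x \<le> h 1 x * h n (T x)"
      using h_submult[of 1 n x] by simp
    also have "\<dots> \<le> exp (F x) * (C * exp (birkhoff_sum F n (T x)))"
      using h_1 Suc h_nonneg by (intro mult_mono) auto
    finally show ?case by (simp add: birkhoff_sum_Suc exp_add mult_ac)
  qed (simp add: h_0)
  have "h K x \<le> C * exp (R K x)"
  \<comment> \<open>Near the end of the orbit a block may no longer fit, and single steps are taken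
    throughout. Off B each exceeds the rate b by at most L + \<bar>b\<bar>, and there are fewer than
    N of them.\<close>
  proof (cases "K < N")
    case True
    have "h K x \<le> C * exp (birkhoff_sum F K x)" by (rule crude)
    also have "birkhoff_sum F K x \<le> birkhoff_sum \<phi> K x + real K * (b + (L + \<bar>b\<bar>))"
      using birkhoff_sum_mono[OF F_le] unfolding birkhoff_sum_add_const .
    also have "\<dots> \<le> R K x"
      using True L(2) mult_right_mono[of "real K" "real N" "L + \<bar>b\<bar>"]
      by (simp add: R_def algebra_simps)
    finally show ?thesis using C by simp
  next
    case False
    show ?thesis
    proof (cases "K = 0")
      case True
      have "C \<le> C * exp (R 0 x)"
        using C L(2) by (simp add: R_def)
      with True h_0[of x] show ?thesis by simp
    next
      case K: False
      show ?thesis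
      proof (cases "x \<in> B")
        case True
        have "h 1 x \<le> exp (F x)" by (rule h_1)
        also have "\<dots> \<le> exp (real 1 * b + birkhoff_sum \<phi> 1 x)"
          using True by (simp add: birkhoff_sum_def \<phi>_def)
        finally show ?thesis using K by (intro step[of 1]) auto
      next
        case x: False
        then obtain n where n: "n \<in> {1..N}" "h n x \<le> exp (real n * b)"
          using B by blast
        then have "h n x \<le> exp (real n * b + birkhoff_sum \<phi> n x)"
          using birkhoff_sum_nonneg[of \<phi> n x] \<phi>_nonneg by (smt (verit) exp_le_cancel_iff)
        with n False show ?thesis by (intro step[of n]) auto
      qed
    qed
  qed
  then show ?case by (simp add: R_def \<phi>_def[abs_def])
qed

text \<open>Each point has a good time by \<open>slow\<close>, but these times are unbounded, which
  obstructs cutting into blocks. Points without a good time up to N, or with F above N, form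
  \<open>B N\<close>. By dominated convergence F + \<bar>b\<bar> has a small integral over
  \<open>B N\<close>, so for large N the visits there raise the rate by at most e / 2; the other e /
  2 absorbs the constants.\<close>

lemma submultiplicative_upper:
  fixes h :: "nat \<Rightarrow> 'a \<Rightarrow> real" and b e :: real
  assumes h_meas [measurable]: "\<And>n. h n \<in> borel_measurable M"
    and h_nonneg: "\<And>n x. 0 \<le> h n x"
    and h_submult: "\<And>m n x. h (m + n) x \<le> h m x * h n ((T ^^ m) x)"
    and h_0: "\<And>x. h 0 x \<le> C" and C: "1 \<le> C"
    and F_int: "integrable M (\<lambda>x. ln (max 1 (h 1 x)))"
    and slow: "AE x in M. \<exists>n\<ge>1. h n x \<le> exp (real n * b)" and e: "0 < e"
  shows "AE x in M. \<forall>\<^sub>F n in sequentially. h n x \<le> exp (real n * (b + e))"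
proof -
  define F where "F x = ln (max 1 (h 1 x))" for x
  have F: "0 \<le> F x" "h 1 x \<le> exp (F x)" for x
    by (auto simp: F_def)
  have [measurable]: "F \<in> borel_measurable M" unfolding F_def by measurable
  have F_int': "integrable M F" using F_int by (simp add: F_def[abs_def])
  define B where "B N = {x. \<not> (\<exists>n\<in>{1..N}. h n x \<le> exp (real n * b)) \<or> real N < F x}" for N
  define \<phi> where "\<phi> N x = indicator (B N) x * (F x + \<bar>b\<bar>)" for N x
  have [measurable]: "\<phi> N \<in> borel_measurable M" for N
    unfolding \<phi>_def B_def by measurable
  have \<phi>_nonneg: "0 \<le> \<phi> N x" for N x
    using F(1)[of x] by (simp add: \<phi>_def)
  have bound_int: "integrable M (\<lambda>x. F x + \<bar>b\<bar>)" using F_int' by simp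
  have \<phi>_int: "integrable M (\<phi> N)" for N
    by (rule Bochner_Integration.integrable_bound[OF bound_int]) (auto simp: \<phi>_def indicator_def)
  have "(\<lambda>N. \<integral>x. \<phi> N x \<partial>M) \<longlonglongrightarrow> (\<integral>x. 0 \<partial>M)"
  proof (rule integral_dominated_convergence[OF _ _ bound_int])
    show "AE x in M. (\<lambda>N. \<phi> N x) \<longlonglongrightarrow> 0"
      using slow
    proof eventually_elim
      case (elim x)
      then obtain n where n: "1 \<le> n" "h n x \<le> exp (real n * b)" by blast
      have "\<forall>\<^sub>F N in sequentially. F x \<le> real N" by real_asymp
      then have "\<forall>\<^sub>F N in sequentially. \<phi> N x = 0"
        using eventually_ge_at_top[of n]
      proof eventually_elim
        case (elim N)
        with n have "x \<notin> B N" by (auto simp: B_def)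
        then show ?case by (simp add: \<phi>_def)
      qed
      then show ?case by (rule tendsto_eventually)
    qed
    show "AE x in M. norm (\<phi> N x) \<le> F x + \<bar>b\<bar>" for N
      using F(1) by (auto simp: \<phi>_def indicator_def)
  qed simp_all
  then have "\<forall>\<^sub>F N in sequentially. (\<integral>x. \<phi> N x \<partial>M) < e / 2"
    using e by (intro order_tendstoD) auto
  then obtain N where N: "(\<integral>x. \<phi> N x \<partial>M) < e / 2"
    by (auto simp: eventually_sequentially)
  have "AE x in M. \<forall>\<^sub>F n in sequentially. birkhoff_sum (\<phi> N) n x \<le> real n * (e / 2)"
    by (rule birkhoff_sum_upper[OF \<phi>_int \<phi>_nonneg N])
  then show ?thesis
  proof eventually_elim
    case (elim x)
    have "\<forall>\<^sub>F n in sequentially. ln C + real N * (real N + \<bar>b\<bar>) \<le> real n * (e / 2)"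
      using e by real_asymp
    with elim show ?case
    proof eventually_elim
      case (elim n)
      have "h n x \<le> C * exp (real n * b + birkhoff_sum (\<phi> N) n x + real N * (real N + \<bar>b\<bar>))"
        unfolding \<phi>_def
        by (rule submultiplicative_block_bound)
           (use h_nonneg h_submult h_0 C F in \<open>auto simp: B_def\<close>)
      also have "\<dots> = exp (ln C + (real n * b + birkhoff_sum (\<phi> N) n x + real N * (real N + \<bar>b\<bar>)))"
        using C by (simp add: exp_add)
      also have "\<dots> \<le> exp (real n * (b + e))"
        using elim by (simp add: algebra_simps)
      finally show ?case .
    qed
  qed
qed

text \<open>The set E, where the lower growth rate is at most b, is subinvariant by
  submultiplicativity. If it is null, the first alternative holds; if it has full measure, almost
  every point has a good time for any rate \<open>d m\<close> > b, and
  \<open>submultiplicative_upper\<close> applies.\<close>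

lemma submultiplicative_dichotomy:
  fixes h :: "nat \<Rightarrow> 'a \<Rightarrow> real" and b e :: real
  assumes h_meas [measurable]: "\<And>n. h n \<in> borel_measurable M"
    and h_nonneg: "\<And>n x. 0 \<le> h n x"
    and h_submult: "\<And>m n x. h (m + n) x \<le> h m x * h n ((T ^^ m) x)"
    and h_0: "\<And>x. h 0 x \<le> C" and C: "1 \<le> C"
    and F_int: "integrable M (\<lambda>x. ln (max 1 (h 1 x)))"
    and e: "0 < e"
  shows "(AE x in M. \<forall>\<^sub>F n in sequentially. exp (real n * b) < h n x)
       \<or> (AE x in M. \<forall>\<^sub>F n in sequentially. h n x \<le> exp (real n * (b + e)))"
proof -
  define d where "d m = b + 1 / real (Suc m)" for m
  define E where "E = {x \<in> space M. \<forall>m. \<exists>\<^sub>F n in sequentially. h n x \<le> exp (real n * d m)}"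
  have E_sets [measurable]: "E \<in> sets M"
    unfolding E_def frequently_sequentially by measurable
  have "T -` E \<inter> space M \<subseteq> E"
  proof
    fix x assume x: "x \<in> T -` E \<inter> space M"
    have "\<exists>\<^sub>F n in sequentially. h n x \<le> exp (real n * d m)" for m
    proof -
      \<comment> \<open>The maximum with 1 provides a finite c with \<open>h 1 x\<close> <= exp c
        even when \<open>h 1 x\<close> is 0.\<close>
      define c where "c = ln (max 1 (h 1 x))"
      have lt: "d (Suc m) < d m"
        unfolding d_def by (simp add: frac_less2)
      have "\<exists>\<^sub>F n in sequentially. h n (T x) \<le> exp (real n * d (Suc m))"
        using x unfolding E_def by auto
      moreover have "\<forall>\<^sub>F n in sequentially. c + real n * d (Suc m) \<le> real (Suc n) * d m"
        using lt by real_asymp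
      ultimately have "\<exists>\<^sub>F n in sequentially. h (Suc n) x \<le> exp (real (Suc n) * d m)"
      proof (rule frequently_rev_mp[OF _ eventually_mono], intro impI)
        fix n assume n: "c + real n * d (Suc m) \<le> real (Suc n) * d m"
          "h n (T x) \<le> exp (real n * d (Suc m))"
        have "h (Suc n) x \<le> h 1 x * h n (T x)"
          using h_submult[of 1 n x] by simp
        also have "\<dots> \<le> exp c * exp (real n * d (Suc m))"
          using n h_nonneg by (intro mult_mono) (auto simp: c_def)
        also have "\<dots> \<le> exp (real (Suc n) * d m)"
          using n(1) by (simp add: exp_add[symmetric])
        finally show "h (Suc n) x \<le> exp (real (Suc n) * d m)" .
      qed
      then show ?thesis
        unfolding frequently_sequentially by (metis le_Suc_eq)
    qed
    then show "x \<in> E" using x by (simp add: E_def)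
  qed
  with E_sets have "prob E = 0 \<or> prob E = 1"
    using prob_subinvariant by blast
  then show ?thesis
  proof
    assume "prob E = 0"
    then have "AE x in M. x \<notin> E" using E_sets by (simp add: prob_eq_0)
    then have "AE x in M. \<forall>\<^sub>F n in sequentially. exp (real n * b) < h n x"
      using AE_space
    proof eventually_elim
      case (elim x)
      then obtain m where "\<forall>\<^sub>F n in sequentially. exp (real n * d m) < h n x"
        unfolding E_def by (auto simp: not_frequently not_le)
      then show ?case
      proof eventually_elim
        case (elim n)
        moreover have "exp (real n * b) \<le> exp (real n * d m)"
          by (auto simp: d_def intro!: mult_left_mono)
        ultimately show ?case by linarith
      qed
    qed
    then show ?thesis ..
  next
    assume "prob E = 1"
    then have AE_E: "AE x in M. x \<in> E" using E_sets by (simp add: prob_eq_1)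
    obtain m where m: "d m < b + e"
      using reals_Archimedean[OF e] by (auto simp: d_def inverse_eq_divide)
    have "AE x in M. \<forall>\<^sub>F n in sequentially. h n x \<le> exp (real n * (d m + (b + e - d m)))"
    proof (rule submultiplicative_upper[OF h_meas h_nonneg h_submult h_0 C F_int])
      show "AE x in M. \<exists>n\<ge>1. h n x \<le> exp (real n * d m)"
        using AE_E
        by eventually_elim (auto simp: E_def frequently_sequentially)
    qed (use m in auto)
    then show ?thesis by simp
  qed
qed

end

section \<open>The norm of the matrix products\<close>

text \<open>The norm of this type is the Frobenius norm. A row of the product combines the rows of B
  with the entries of a row of A as coefficients, and Cauchy-Schwarz bounds it.\<close>

lemma norm_matrix_mult_le:
  fixes A :: "real^'n^'m" and B :: "real^'k^'n"
  shows "norm (A ** B) \<le> norm A * norm B"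
proof -
  have row: "norm ((A ** B) $ i) \<le> norm (A $ i) * norm B" for i
  proof -
    have "(A ** B) $ i = (\<Sum>j\<in>UNIV. A $ i $ j *\<^sub>R B $ j)"
      by (simp add: matrix_matrix_mult_def vec_eq_iff)
    then have "norm ((A ** B) $ i) \<le> (\<Sum>j\<in>UNIV. \<bar>A $ i $ j\<bar> * \<bar>norm (B $ j)\<bar>)"
      using norm_sum[of "\<lambda>j. A $ i $ j *\<^sub>R B $ j" UNIV] by simp
    also have "\<dots> \<le> L2_set (\<lambda>j. A $ i $ j) UNIV * L2_set (\<lambda>j. norm (B $ j)) UNIV"
      by (rule L2_set_mult_ineq)
    also have "L2_set (\<lambda>j. A $ i $ j) UNIV = norm (A $ i)"
      by (simp add: norm_vec_def L2_set_def)
    finally show ?thesis by (simp add: norm_vec_def)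
  qed
  have "norm (A ** B) \<le> L2_set (\<lambda>i. norm B * norm (A $ i)) UNIV"
    unfolding norm_vec_def[of "A ** B"]
    by (rule L2_set_mono) (use row in \<open>auto simp: mult.commute\<close>)
  also have "\<dots> = norm B * norm A"
    by (simp add: L2_set_right_distrib norm_vec_def)
  finally show ?thesis by (simp add: mult.commute)
qed

lemma norm_matrix_vector_mult_le:
  fixes A :: "real^'n^'m" and x :: "real^'n"
  shows "norm (A *v x) \<le> norm A * norm x"
proof -
  have "\<bar>(A *v x) $ i\<bar> \<le> norm x * norm (A $ i)" for i
    using Cauchy_Schwarz_ineq2[of "A $ i" x] by (simp add: matrix_vector_mul_component mult.commute)
  then have "norm (A *v x) \<le> L2_set (\<lambda>i. norm x * norm (A $ i)) UNIV"
    unfolding norm_vec_def[of "A *v x"] by (intro L2_set_mono) auto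
  also have "\<dots> = norm x * norm A"
    by (simp add: L2_set_right_distrib norm_vec_def)
  finally show ?thesis by (simp add: mult.commute)
qed

lemma norm_matrix_le_sum:
  fixes A :: "real^'n^'m"
  shows "norm A \<le> (\<Sum>i\<in>UNIV. \<Sum>k\<in>UNIV. \<bar>A $ i $ k\<bar>)"
proof -
  have "norm A \<le> (\<Sum>i\<in>UNIV. norm (A $ i))"
    unfolding norm_vec_def[of A] by (rule L2_set_le_sum) simp
  also have "\<dots> \<le> (\<Sum>i\<in>UNIV. \<Sum>k\<in>UNIV. \<bar>A $ i $ k\<bar>)"
    by (intro sum_mono norm_le_l1_cart)
  finally show ?thesis .
qed

lemma borel_measurable_matrix_mult [measurable (raw)]:
  fixes f :: "'a \<Rightarrow> real^'n^'m" and g :: "'a \<Rightarrow> real^'k^'n"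
  assumes "f \<in> borel_measurable M" "g \<in> borel_measurable M"
  shows "(\<lambda>x. f x ** g x) \<in> borel_measurable M"
proof (rule borel_measurable_continuous_Pair[OF assms])
  show "continuous_on UNIV (\<lambda>x::(real^'n^'m) \<times> (real^'k^'n). fst x ** snd x)"
    unfolding matrix_matrix_mult_def by (intro continuous_intros)
qed

lemma fwd_prod_cong:
  assumes "\<And>k. 1 \<le> k \<Longrightarrow> k \<le> n \<Longrightarrow> B k = C k"
  shows "fwd_prod B n = fwd_prod C n"
  using assms by (induction n) auto

lemma fwd_prod_add: "fwd_prod B (m + n) = fwd_prod (\<lambda>k. B (k + m)) n ** fwd_prod B m"
  by (induction n) (simp_all add: matrix_mul_assoc add.commute)

lemma fwd_prod_measurable [measurable]:
  fixes A :: "nat \<Rightarrow> 'w \<Rightarrow> real^'p^'p"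
  assumes "\<And>n. 1 \<le> n \<Longrightarrow> A n \<in> borel_measurable M"
  shows "(\<lambda>\<omega>. fwd_prod (realization A \<omega>) n) \<in> borel_measurable M"
proof (induction n)
  case (Suc n)
  note [measurable] = Suc assms[of "Suc n", simplified]
  have "(\<lambda>\<omega>. A (Suc n) \<omega> ** fwd_prod (realization A \<omega>) n) \<in> borel_measurable M"
    by measurable
  then show ?case by (simp add: realization_def)
qed simp

section \<open>The shift on sequences as an ergodic system\<close>

definition shift :: "(nat \<Rightarrow> 'a) \<Rightarrow> nat \<Rightarrow> 'a" where
  "shift s = (\<lambda>n. s (Suc n))"

lemma funpow_shift: "(shift ^^ m) s = (\<lambda>n. s (n + m))"
  by (induction m arbitrary: s) (auto simp: shift_def)

lemma seq_process_measurable: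
  assumes "\<And>n. 1 \<le> n \<Longrightarrow> A n \<in> borel_measurable P"
  shows "(\<lambda>\<omega> n. A (Suc n) \<omega>) \<in> measurable P seq_space"
  using assms by (intro measurable_PiM_single') (auto simp: space_PiM)

text \<open>No transformation of the space of P is given: stationarity and ergodicity are properties
  of the law of the sequence, so the system lives on that law. Invariance is stationarity for k =
  1.\<close>

lemma ergodic_system_shift:
  fixes A :: "nat \<Rightarrow> 'w \<Rightarrow> 'a::topological_space"
  assumes "prob_space P"
    and A: "\<And>n. 1 \<le> n \<Longrightarrow> A n \<in> borel_measurable P"
    and "strictly_stationary P A" and erg: "ergodic_process P A"
  shows "ergodic_system (distr P seq_space (\<lambda>\<omega> n. A (Suc n) \<omega>)) shift"
proof -
  interpret P: prob_space P by fact
  let ?Q = "distr P seq_space (\<lambda>\<omega> n. A (Suc n) \<omega>)"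
  have X: "(\<lambda>\<omega> n. A (Suc n) \<omega>) \<in> measurable P seq_space"
    using A by (rule seq_process_measurable)
  have shift_meas: "shift \<in> measurable (seq_space :: (nat \<Rightarrow> 'a) measure) seq_space"
    unfolding shift_def by (intro measurable_PiM_single') (auto simp: space_PiM)
  interpret Q: prob_space ?Q using X by (rule P.prob_space_distr)
  show ?thesis
  proof unfold_locales
    show "shift \<in> measurable ?Q ?Q" using shift_meas by simp
    have "distr ?Q ?Q shift = distr ?Q seq_space shift" by (rule distr_cong) auto
    also have "\<dots> = distr P seq_space (shift \<circ> (\<lambda>\<omega> n. A (Suc n) \<omega>))"
      using shift_meas X by (rule distr_distr)
    also have "shift \<circ> (\<lambda>\<omega> n. A (Suc n) \<omega>) = (\<lambda>\<omega> n. A (Suc (n + 1)) \<omega>)"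
      by (auto simp: shift_def)
    also have "distr P seq_space \<dots> = ?Q"
      using assms(3) unfolding strictly_stationary_def by blast
    finally show "distr ?Q ?Q shift = ?Q" .
    fix S assume S: "S \<in> sets ?Q" "shift -` S \<inter> space ?Q = S"
    then have "(\<lambda>s n. s (Suc n)) -` S = S"
      by (simp add: shift_def[abs_def] space_PiM)
    then have "measure P {\<omega> \<in> space P. (\<lambda>n. A (Suc n) \<omega>) \<in> S} \<in> {0, 1}"
      using erg S(1) unfolding ergodic_process_def by simp
    also have "{\<omega> \<in> space P. (\<lambda>n. A (Suc n) \<omega>) \<in> S} = (\<lambda>\<omega> n. A (Suc n) \<omega>) -` S \<inter> space P"
      by auto
    finally show "measure ?Q S \<in> {0, 1}"
      using S(1) X by (simp add: measure_distr)
  qed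
qed

lemma fwd_prod_norm_dichotomy:
  fixes A :: "nat \<Rightarrow> 'w \<Rightarrow> real^'p^'p" and b e :: real
  assumes "prob_space P"
    and A: "\<And>n. 1 \<le> n \<Longrightarrow> A n \<in> borel_measurable P"
    and "strictly_stationary P A" and "ergodic_process P A"
    and int: "integrable P (\<lambda>\<omega>. ln (max 1 (norm (A 1 \<omega>))))"
    and e: "0 < e"
  shows "(AE \<omega> in P. \<forall>\<^sub>F n in sequentially. exp (real n * b) < norm (fwd_prod (realization A \<omega>) n))
       \<or> (AE \<omega> in P. \<forall>\<^sub>F n in sequentially. norm (fwd_prod (realization A \<omega>) n) \<le> exp (real n * (b + e)))"
proof -
  let ?X = "\<lambda>\<omega> n. A (Suc n) \<omega>"
  interpret ergodic_system "distr P seq_space ?X" shift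
    using assms by (intro ergodic_system_shift)
  have X: "?X \<in> measurable P seq_space" using A by (rule seq_process_measurable)
  \<comment> \<open>\<open>fwd_prod\<close> reads its argument from index 1, while position 0 of a
    point of the sequence space holds the first matrix.\<close>
  define h where "h n s = norm (fwd_prod (\<lambda>k. s (k - 1) :: real^'p^'p) n)" for n s
  have h_meas: "h n \<in> borel_measurable (distr P seq_space ?X)" for n
  proof -
    have "(\<lambda>s. fwd_prod (realization (\<lambda>k s. s (k - 1) :: real^'p^'p) s) n) \<in> borel_measurable seq_space"
      by (rule fwd_prod_measurable) simp
    then show ?thesis unfolding h_def realization_def by simp
  qed
  have h_nonneg: "0 \<le> h n s" for n s
    by (simp add: h_def)
  have h_X: "h n (?X \<omega>) = norm (fwd_prod (realization A \<omega>) n)" for n \<omega>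
    unfolding h_def by (intro arg_cong[where f = norm] fwd_prod_cong) (auto simp: realization_def)
  have "h (m + n) s \<le> h m s * h n ((shift ^^ m) s)" for m n s
  proof -
    have "fwd_prod (\<lambda>k. s (k + m - 1)) n = fwd_prod (\<lambda>k. (shift ^^ m) s (k - 1)) n"
      by (rule fwd_prod_cong) (simp add: funpow_shift)
    then show ?thesis
      unfolding h_def fwd_prod_add[of _ m n] by (metis mult.commute norm_matrix_mult_le)
  qed
  moreover have "integrable (distr P seq_space ?X) (\<lambda>s. ln (max 1 (h 1 s)))"
  proof (subst integrable_distr_eq[OF X])
    show "(\<lambda>s. ln (max 1 (h 1 s))) \<in> borel_measurable seq_space"
      using h_meas[of 1] by simp
    show "integrable P (\<lambda>\<omega>. ln (max 1 (h 1 (?X \<omega>))))"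
      using int unfolding h_X by (simp add: realization_def)
  qed
  \<comment> \<open>The Frobenius norm of the identity is the square root of the dimension, hence a
    constant C in place of 1.\<close>
  ultimately have "(AE s in distr P seq_space ?X. \<forall>\<^sub>F n in sequentially. exp (real n * b) < h n s)
       \<or> (AE s in distr P seq_space ?X. \<forall>\<^sub>F n in sequentially. h n s \<le> exp (real n * (b + e)))"
    using h_meas e
    by (intro submultiplicative_dichotomy[where C = "max 1 (norm (mat 1 :: real^'p^'p))"])
       (simp_all add: h_def[of 0] h_nonneg)
  then show ?thesis
    using AE_distrD[OF X, of "\<lambda>s. \<forall>\<^sub>F n in sequentially. exp (real n * b) < h n s"]
      AE_distrD[OF X, of "\<lambda>s. \<forall>\<^sub>F n in sequentially. h n s \<le> exp (real n * (b + e))"]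
    unfolding h_X by blast
qed

section \<open>Lyapunov exponents\<close>

text \<open>At n = 0 the factor would be 1 / 0 = 0 and the left side would read 0 <= c; thus
  positivity of n matters. For u = 0 both sides are true.\<close>

lemma scaled_log_ereal_le_iff:
  assumes "0 \<le> u" "0 < n"
  shows "ereal (1 / real n) * log_ereal u \<le> ereal c \<longleftrightarrow> u \<le> exp (real n * c)"
proof (cases "u = 0")
  case False
  then have "u \<le> exp (real n * c) \<longleftrightarrow> ln u \<le> real n * c"
    using assms(1) ln_le_cancel_iff[of u "exp (real n * c)"] by simp
  with False assms show ?thesis
    by (simp add: log_ereal_def field_simps)
qed (use assms in \<open>simp add: log_ereal_def\<close>)

text \<open>The general filter serves both \<open>lyap\<close> and the limsup over the times at
  which a row is nonzero.\<close>

lemma Limsup_scaled_log_le: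
  assumes F: "F \<le> sequentially" and "\<And>n. 0 \<le> u n"
    and "\<forall>\<^sub>F n in F. u n \<le> exp (real n * c)"
  shows "Limsup F (\<lambda>n. ereal (1 / real n) * log_ereal (u n)) \<le> ereal c"
proof (rule Limsup_bounded)
  have "\<forall>\<^sub>F n in F. 0 < n"
    using filter_leD[OF F eventually_gt_at_top[of 0]] .
  with assms(3) show "\<forall>\<^sub>F n in F. ereal (1 / real n) * log_ereal (u n) \<le> ereal c"
    by eventually_elim (simp add: scaled_log_ereal_le_iff assms(2))
qed

lemma lyap_leI:
  assumes "\<forall>\<^sub>F n in sequentially. norm (fwd_prod B n *v x) \<le> exp (real n * c)"
  shows "lyap B x \<le> ereal c"
  unfolding lyap_def by (rule Limsup_scaled_log_le) (use assms in auto)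

lemma lyap_lessD:
  assumes "lyap B x < ereal c"
  shows "\<forall>\<^sub>F n in sequentially. norm (fwd_prod B n *v x) \<le> exp (real n * c)"
  using Limsup_lessD[OF assms[unfolded lyap_def]] eventually_gt_at_top[of 0]
proof eventually_elim
  case (elim n)
  then show ?case by (subst scaled_log_ereal_le_iff[symmetric]) auto
qed

lemma eventually_const_mult_exp_le:
  fixes c d K :: real
  assumes "c < d"
  shows "\<forall>\<^sub>F n in sequentially. K * exp (real n * c) \<le> exp (real n * d)"
proof -
  have "\<forall>\<^sub>F n in sequentially. \<bar>K\<bar> \<le> exp (real n * (d - c))"
    using assms by real_asymp
  then show ?thesis
  proof eventually_elim
    case (elim n)
    have "K * exp (real n * c) \<le> exp (real n * (d - c)) * exp (real n * c)"
      using elim by (intro mult_right_mono) auto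
    then show ?case by (simp add: exp_add[symmetric] algebra_simps)
  qed
qed

text \<open>A strict bound leaves room for a rate d between c and \<mu> whose exponential absorbs K.
  For this reason closure under sums and multiples is derived for strict bounds.\<close>

lemma lyap_lessI:
  assumes "\<forall>\<^sub>F n in sequentially. norm (fwd_prod B n *v x) \<le> K * exp (real n * c)" "ereal c < \<mu>"
  shows "lyap B x < \<mu>"
proof -
  obtain d where d: "ereal c < ereal d" "ereal d < \<mu>" using ereal_dense2[OF assms(2)] by blast
  then have "c < d" by simp
  then have "\<forall>\<^sub>F n in sequentially. K * exp (real n * c) \<le> exp (real n * d)"
    by (rule eventually_const_mult_exp_le)
  with assms(1) have "\<forall>\<^sub>F n in sequentially. norm (fwd_prod B n *v x) \<le> exp (real n * d)"
    by eventually_elim linarith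
  then have "lyap B x \<le> ereal d" by (rule lyap_leI)
  with d show ?thesis by simp
qed

lemma lyap_zero [simp]: "lyap B 0 = -\<infinity>"
proof -
  have "lyap B 0 \<le> ereal c" for c
    by (rule lyap_leI) simp
  then show ?thesis by (simp add: ereal_bot)
qed

lemma lyap_scaleR_less:
  assumes "lyap B x < \<mu>"
  shows "lyap B (a *\<^sub>R x) < \<mu>"
proof -
  obtain c where c: "lyap B x < ereal c" "ereal c < \<mu>" using ereal_dense2[OF assms] by blast
  show ?thesis
  proof (rule lyap_lessI[OF _ c(2)])
    show "\<forall>\<^sub>F n in sequentially. norm (fwd_prod B n *v (a *\<^sub>R x)) \<le> \<bar>a\<bar> * exp (real n * c)"
      using lyap_lessD[OF c(1)]
      by eventually_elim (simp add: matrix_vector_mult_scaleR mult_left_mono)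
  qed
qed

lemma lyap_add_less:
  assumes "lyap B x < \<mu>" "lyap B y < \<mu>"
  shows "lyap B (x + y) < \<mu>"
proof -
  obtain c where c: "max (lyap B x) (lyap B y) < ereal c" "ereal c < \<mu>"
    using ereal_dense2[of "max (lyap B x) (lyap B y)" \<mu>] assms by auto
  then have "lyap B x < ereal c" "lyap B y < ereal c" by auto
  then have "\<forall>\<^sub>F n in sequentially. norm (fwd_prod B n *v x) \<le> exp (real n * c)"
    "\<forall>\<^sub>F n in sequentially. norm (fwd_prod B n *v y) \<le> exp (real n * c)"
    by (auto intro: lyap_lessD)
  then have "\<forall>\<^sub>F n in sequentially. norm (fwd_prod B n *v (x + y)) \<le> 2 * exp (real n * c)"
  proof eventually_elim
    case (elim n)
    then show ?case
      using norm_triangle_ineq[of "fwd_prod B n *v x" "fwd_prod B n *v y"]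
      by (simp add: matrix_vector_right_distrib)
  qed
  then show ?thesis using c(2) by (rule lyap_lessI)
qed

text \<open>Inserting 0 matters for \<mu> = -\<infinity>, where the strict sublevel set is
  empty.\<close>

lemma subspace_lyap_less: "subspace (insert 0 {x. lyap B x < \<mu>})"
  unfolding subspace_def by (auto intro: lyap_add_less lyap_scaleR_less)

lemma subspace_lyap_le: "subspace {x. lyap B x \<le> \<mu>}"
proof -
  \<comment> \<open>By density of the order, a weak sublevel set is an intersection of strict
    ones.\<close>
  have le_iff: "lyap B x \<le> \<mu> \<longleftrightarrow> (\<forall>\<nu>>\<mu>. lyap B x < \<nu>)" for x
    by (meson dense dual_order.strict_trans2 leI order.strict_trans1 order.asym)
  show ?thesis
    unfolding subspace_def le_iff by (auto intro: lyap_add_less lyap_scaleR_less)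
qed

lemma lyap_mult_pos:
  assumes "\<mu> \<in> lyap_values B"
  shows "0 < lyap_mult B \<mu>"
proof -
  obtain x where x: "x \<noteq> 0" "lyap B x = \<mu>"
    using assms by (auto simp: lyap_values_def)
  have "insert 0 {x. lyap B x < \<mu>} \<subset> {x. lyap B x \<le> \<mu>}"
    using x by (auto simp: less_le)
  then have "span (insert 0 {x. lyap B x < \<mu>}) \<subset> span {x. lyap B x \<le> \<mu>}"
    by (metis span_eq_iff subspace_lyap_le subspace_lyap_less)
  then have "dim (insert 0 {x. lyap B x < \<mu>}) < dim {x. lyap B x \<le> \<mu>}"
    by (rule dim_psubset)
  then show ?thesis by (simp add: lyap_mult_def)
qed

lemma lyap_exponent_in_values:
  assumes "lyap_exponent B k \<noteq> -\<infinity>" "1 \<le> k"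
  shows "lyap_exponent B k \<in> lyap_values B"
proof -
  have k: "k - 1 < length (lyap_spectrum B)"
    using assms by (auto simp: lyap_exponent_def split: if_splits)
  then have "lyap_exponent B k \<in> set (lyap_spectrum B)"
    using assms by (auto simp: lyap_exponent_def split: if_splits)
  also have "set (lyap_spectrum B) \<subseteq> set (sorted_list_of_set (lyap_values B))"
    by (auto simp: lyap_spectrum_def)
  \<comment> \<open>On an infinite set \<open>sorted_list_of_set\<close> returns the empty list, and
    the inclusion is trivial.\<close>
  also have "\<dots> \<subseteq> lyap_values B"
    by (cases "finite (lyap_values B)") auto
  finally show ?thesis .
qed

text \<open>A largest value a of multiplicity two or more would fill both first places of the
  spectrum. The gap thus forces multiplicity one, which says that the vectors of rate below a have
  codimension one.\<close>

lemma lyap_gap_hyperplane: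
  fixes B :: "nat \<Rightarrow> real^'p^'p"
  assumes gap: "lyap_exponent B 2 < lyap_exponent B 1"
  obtains v where "v \<noteq> 0" "\<And>x. v \<bullet> x = 0 \<Longrightarrow> lyap B x \<le> lyap_exponent B 2"
proof -
  define xs where "xs = rev (sorted_list_of_set (lyap_values B))"
  have spectrum: "lyap_spectrum B = concat (map (\<lambda>\<mu>. replicate (lyap_mult B \<mu>) \<mu>) xs)"
    by (simp add: lyap_spectrum_def xs_def)
  \<comment> \<open>Finiteness of the set of values comes from the gap: otherwise the list is empty
    and both exponents take the default -\<infinity>.\<close>
  have "xs \<noteq> []"
    using gap by (auto simp: lyap_exponent_def spectrum)
  then have fin: "finite (lyap_values B)"
    by (metis rev.simps(1) sorted_list_of_set.fold_insort_key.infinite xs_def)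
  then have set_xs: "set xs = lyap_values B"
    by (simp add: xs_def)
  have sorted: "sorted_wrt (>) xs"
    using strict_sorted_list_of_set[of "lyap_values B"] by (simp add: xs_def sorted_wrt_rev)
  obtain a ys where xs: "xs = a # ys" using \<open>xs \<noteq> []\<close> by (cases xs) auto
  have a_in: "a \<in> lyap_values B" using set_xs xs by auto
  have "lyap B x \<le> a" for x
  proof (cases "x = 0")
    case False
    then have "lyap B x \<in> set xs" using set_xs by (auto simp: lyap_values_def)
    then show ?thesis using sorted xs by auto
  qed simp
  then have le_a: "{x. lyap B x \<le> a} = UNIV" by auto
  obtain m where m: "lyap_mult B a = Suc m"
    using lyap_mult_pos[OF a_in] gr0_implies_Suc by blast
  have first: "lyap_exponent B 1 = a"
    using m by (simp add: lyap_exponent_def spectrum xs)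
  have "m = 0"
  proof (rule ccontr)
    assume "m \<noteq> 0"
    then obtain m' where "m = Suc m'" using not0_implies_Suc by blast
    with m have "lyap_exponent B 2 = a"
      by (simp add: lyap_exponent_def spectrum xs)
    with first gap show False by simp
  qed
  with m have mult: "lyap_mult B a = 1" by simp
  \<comment> \<open>In decreasing order the value after a comes first in \<open>ys\<close>, and as a
    occurs once, it is the second exponent. With a the only value, \<open>ys\<close> is empty and
    the claim is vacuous.\<close>
  have second: "\<mu> \<le> lyap_exponent B 2" if \<mu>: "\<mu> \<in> set ys" for \<mu>
  proof -
    obtain b zs where ys: "ys = b # zs" using \<mu> by (cases ys) auto
    have "b \<in> lyap_values B" using set_xs xs ys by auto
    then obtain k where "lyap_mult B b = Suc k"
      using lyap_mult_pos gr0_implies_Suc by blast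
    then have "lyap_exponent B 2 = b"
      using mult by (simp add: lyap_exponent_def spectrum xs ys)
    then show ?thesis using \<mu> sorted xs ys by auto
  qed
  define W where "W = insert 0 {x. lyap B x < a}"
  have "DIM(real^'p) - dim W = 1"
    using mult unfolding lyap_mult_def le_a W_def by (simp add: dim_UNIV)
  then have "dim W = DIM(real^'p) - 1" by linarith
  then obtain v where v: "v \<noteq> 0" "span W = {x. v \<bullet> x = 0}"
    by (rule lowdim_eq_hyperplane)
  moreover have "span W = W"
    unfolding W_def by (subst span_eq_iff) (rule subspace_lyap_less)
  ultimately have W: "x \<in> W" if "v \<bullet> x = 0" for x using that by auto
  have "lyap B x \<le> lyap_exponent B 2" if "v \<bullet> x = 0" for x
  proof (cases "x = 0")
    case False
    with W[OF that] have "lyap B x < a" by (simp add: W_def)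
    moreover have "lyap B x \<in> set xs" using False set_xs by (auto simp: lyap_values_def)
    ultimately show ?thesis using xs by (auto intro: second)
  qed simp
  with v(1) show ?thesis by (rule that)
qed

section \<open>Products with a spectral gap\<close>

lemma fwd_prod_nonneg:
  assumes "\<And>n. 1 \<le> n \<Longrightarrow> nonneg_matrix (B n)"
  shows "0 \<le> fwd_prod B n $ i $ k"
proof (induction n arbitrary: i k)
  case (Suc n)
  then show ?case
    using assms[of "Suc n"] by (simp add: matrix_matrix_mult_def nonneg_matrix_def sum_nonneg)
qed (simp add: mat_def)

text \<open>The comparison holds at time \<open>m\<close> by the shape of the rows, and left multiplication by nonnegative
  matrices preserves it.\<close>

lemma fwd_prod_entry_le:
  fixes B :: "nat \<Rightarrow> real^'p^'p" and w :: "real^'p"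
  assumes nonneg: "\<And>n. 1 \<le> n \<Longrightarrow> nonneg_matrix (B n)"
    and rows: "\<And>i. (\<forall>k. 0 < fwd_prod B m $ i $ k) \<or> (\<forall>k. fwd_prod B m $ i $ k = 0)"
    and w: "\<And>k. 0 \<le> w $ k" "w \<noteq> 0"
  obtains K where "0 < K"
    and "\<And>n i k. m \<le> n \<Longrightarrow> fwd_prod B n $ i $ k \<le> K * (fwd_prod B n *v w) $ i"
proof -
  obtain l where l: "0 < w $ l"
    using w by (metis less_eq_real_def vec_eq_iff zero_index)
  \<comment> \<open>A zero row gives 0 / 0 = 0 here and is treated separately. In K, the sum
    dominates every quotient and the summand 1 secures positivity.\<close>
  define Q where "Q i k = fwd_prod B m $ i $ k / (fwd_prod B m *v w) $ i" for i k
  define K where "K = 1 + (\<Sum>i\<in>UNIV. \<Sum>k\<in>UNIV. \<bar>Q i k\<bar>)"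
  have K: "0 < K"
    unfolding K_def by (intro add_pos_nonneg sum_nonneg) auto
  have Q_le: "Q i k \<le> K" for i k
  proof -
    have "\<bar>Q i k\<bar> \<le> (\<Sum>k\<in>UNIV. \<bar>Q i k\<bar>)" by (rule member_le_sum) auto
    also have "\<dots> \<le> (\<Sum>i\<in>UNIV. \<Sum>k\<in>UNIV. \<bar>Q i k\<bar>)"
      by (rule member_le_sum[of i UNIV "\<lambda>i. \<Sum>k\<in>UNIV. \<bar>Q i k\<bar>"]) (auto intro: sum_nonneg)
    finally show ?thesis by (simp add: K_def)
  qed
  have "fwd_prod B n $ i $ k \<le> K * (fwd_prod B n *v w) $ i" if "m \<le> n" for n i k
    using that
  proof (induction n arbitrary: i k rule: dec_induct)
    case base
    show ?case
    proof (cases "\<forall>k. fwd_prod B m $ i $ k = 0")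
      case True
      then show ?thesis by (simp add: matrix_vector_mult_def)
    next
      case False
      with rows have pos: "0 < fwd_prod B m $ i $ k" for k by blast
      have "0 < (\<Sum>k\<in>UNIV. fwd_prod B m $ i $ k * w $ k)"
        by (rule sum_pos2[of UNIV l]) (use pos l w in \<open>auto simp: less_imp_le\<close>)
      then have "0 < (fwd_prod B m *v w) $ i" by (simp add: matrix_vector_mult_def)
      with Q_le[of i k] show ?thesis by (simp add: Q_def divide_simps)
    qed
  next
    case (step n)
    have "fwd_prod B (Suc n) $ i $ k = (\<Sum>j\<in>UNIV. B (Suc n) $ i $ j * fwd_prod B n $ j $ k)"
      by (simp add: matrix_matrix_mult_def)
    also have "\<dots> \<le> (\<Sum>j\<in>UNIV. B (Suc n) $ i $ j * (K * (fwd_prod B n *v w) $ j))"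
      using nonneg[of "Suc n"] step by (intro sum_mono mult_left_mono) (auto simp: nonneg_matrix_def)
    also have "\<dots> = K * (B (Suc n) *v (fwd_prod B n *v w)) $ i"
      by (simp add: matrix_vector_mult_def[of "B (Suc n)"] sum_distrib_left mult_ac)
    also have "B (Suc n) *v (fwd_prod B n *v w) = fwd_prod B (Suc n) *v w"
      by (simp add: matrix_vector_mul_assoc)
    finally show ?case .
  qed
  with K show ?thesis by (rule that)
qed

text \<open>The properties shared by almost all realizations; within the locale nothing is random.
  \<open>growth\<close> is the liminf information that the exponents, being limsups, do not
  contain.\<close>

locale positive_product =
  fixes B :: "nat \<Rightarrow> real^'p^'p" and lam1 lam2 :: ereal
  assumes nonneg: "\<And>n. 1 \<le> n \<Longrightarrow> nonneg_matrix (B n)"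
    and rows: "\<exists>m. \<forall>i. (\<forall>k. 0 < fwd_prod B m $ i $ k) \<or> (\<forall>k. fwd_prod B m $ i $ k = 0)"
    and exponents: "lyap_exponent B 1 = lam1" "lyap_exponent B 2 = lam2" and gap: "lam2 < lam1"
    and growth: "\<And>b. ereal b < lam1 \<Longrightarrow> \<forall>\<^sub>F n in sequentially. exp (real n * b) < norm (fwd_prod B n)"
begin

lemma entry_nonneg: "0 \<le> fwd_prod B n $ i $ k"
  using nonneg by (rule fwd_prod_nonneg)

lemma eventually_entry_le:
  assumes "\<And>k. 0 \<le> w $ k" "w \<noteq> 0"
  obtains K where "0 < K"
    and "\<forall>\<^sub>F n in sequentially. \<forall>i k. fwd_prod B n $ i $ k \<le> K * (fwd_prod B n *v w) $ i"
proof -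
  obtain m where "\<And>i. (\<forall>k. 0 < fwd_prod B m $ i $ k) \<or> (\<forall>k. fwd_prod B m $ i $ k = 0)"
    using rows by blast
  from fwd_prod_entry_le[OF nonneg this assms] obtain K where
    "0 < K" "\<And>n i k. m \<le> n \<Longrightarrow> fwd_prod B n $ i $ k \<le> K * (fwd_prod B n *v w) $ i"
    by blast
  then show ?thesis
    using that[of K] unfolding eventually_sequentially by blast
qed

lemma gap_reals:
  obtains b c where "lam2 < ereal c" "c < b" "ereal b < lam1"
  using ereal_dense2[OF gap] by (metis ereal_dense2 ereal_less_eq(3) linorder_not_le)

text \<open>All entries of M_n are at most K times coordinates of M_n w. If M_n w grew at a rate at
  most lam2, so would the whole matrix, against \<open>growth\<close>.\<close>

lemma lyap_nonneg_vector_gt: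
  assumes w: "\<And>k. 0 \<le> w $ k" "w \<noteq> 0"
  shows "lam2 < lyap B w"
proof (rule ccontr)
  assume "\<not> lam2 < lyap B w"
  moreover obtain b c where bc: "lam2 < ereal c" "c < b" "ereal b < lam1" by (rule gap_reals)
  ultimately have "lyap B w < ereal c" by simp
  then have small: "\<forall>\<^sub>F n in sequentially. norm (fwd_prod B n *v w) \<le> exp (real n * c)"
    by (rule lyap_lessD)
  obtain K where K: "0 < K"
    "\<forall>\<^sub>F n in sequentially. \<forall>i k. fwd_prod B n $ i $ k \<le> K * (fwd_prod B n *v w) $ i"
    using w by (rule eventually_entry_le)
  define p where "p = real CARD('p)"
  have "\<forall>\<^sub>F n in sequentially. (p * (p * K)) * exp (real n * c) \<le> exp (real n * b)"
    using bc(2) by (rule eventually_const_mult_exp_le)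
  with small K(2) growth[OF bc(3)] have "\<forall>\<^sub>F n in sequentially. False"
  proof eventually_elim
    case (elim n)
    have "norm (fwd_prod B n) \<le> (\<Sum>i\<in>UNIV. \<Sum>k\<in>UNIV. \<bar>fwd_prod B n $ i $ k\<bar>)"
      by (rule norm_matrix_le_sum)
    also have "\<dots> \<le> (\<Sum>i\<in>(UNIV::'p set). \<Sum>k\<in>(UNIV::'p set). K * exp (real n * c))"
    proof (intro sum_mono)
      fix i k
      have "\<bar>fwd_prod B n $ i $ k\<bar> \<le> K * (fwd_prod B n *v w) $ i"
        using elim(2) entry_nonneg[of n i k] by simp
      also have "\<dots> \<le> K * exp (real n * c)"
        using K(1) elim(1) component_le_norm_cart[of "fwd_prod B n *v w" i]
        by (intro mult_left_mono) auto
      finally show "\<bar>fwd_prod B n $ i $ k\<bar> \<le> K * exp (real n * c)" .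
    qed
    also have "\<dots> = (p * (p * K)) * exp (real n * c)"
      by (simp add: p_def mult_ac)
    finally show ?case using elim by linarith
  qed
  then show False by simp
qed

text \<open>The hyperplane of slower growth meets the closed positive orthant only at \<open>0\<close>, hence its normal
  vector has entries of one strict sign.\<close>

lemma positive_normal:
  obtains v where "\<And>k. 0 < v $ k" "\<And>x. v \<bullet> x = 0 \<Longrightarrow> lyap B x \<le> lam2"
proof -
  obtain v where "v \<noteq> 0" and v: "\<And>x. v \<bullet> x = 0 \<Longrightarrow> lyap B x \<le> lam2"
    using lyap_gap_hyperplane[of B] gap exponents by metis
  have nz: "v \<bullet> w \<noteq> 0" if "\<And>k. 0 \<le> w $ k" "w \<noteq> 0" for w
    using lyap_nonneg_vector_gt[OF that] v[of w] by auto
  have comp_nz: "v $ k \<noteq> 0" for k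
  proof -
    have "0 \<le> axis k (1::real) $ j" for j by (simp add: axis_def)
    moreover have "axis k (1::real) \<noteq> 0" by (simp add: axis_eq_0_iff)
    ultimately have "v \<bullet> axis k 1 \<noteq> 0" by (rule nz)
    then show ?thesis by (simp add: inner_axis)
  qed
  have same_sign: "0 < v $ l" if "0 < v $ k" for k l
  proof (rule ccontr)
    assume "\<not> 0 < v $ l"
    with comp_nz[of l] have l: "v $ l < 0" by linarith
    \<comment> \<open>With v_l < 0 < v_k both coefficients are positive, and they are chosen so that
      the two contributions to v \<bullet> w cancel.\<close>
    define w where "w = (- v $ l) *\<^sub>R axis k 1 + (v $ k) *\<^sub>R axis l (1::real)"
    have "v \<bullet> w = 0"
      by (simp add: w_def inner_add_right inner_diff_right inner_axis)
    moreover have "0 \<le> w $ j" for j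
      using that l by (auto simp: w_def axis_def)
    moreover have "w \<noteq> 0"
    proof
      assume "w = 0"
      then have "w $ k = 0" by simp
      moreover have "k \<noteq> l" using that l by auto
      ultimately show False using l by (simp add: w_def axis_def)
    qed
    ultimately show False using nz by blast
  qed
  show ?thesis
  proof (cases "\<exists>k. 0 < v $ k")
    case True
    then show ?thesis using that[of v] v same_sign by blast
  next
    case False
    then have "0 < (- v) $ k" for k
      using comp_nz[of k] by (simp add: not_less) (metis less_eq_real_def)
    moreover have "lyap B x \<le> lam2" if "(- v) \<bullet> x = 0" for x
      using v[of x] that by simp
    ultimately show ?thesis using that[of "- v"] by blast
  qed
qed

text \<open>Expresses the normalised normal vector through the matrices alone. The random vector of
  the theorem is defined by this limit, which makes it measurable.\<close>

lemma column_sum_ratio_tendsto: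
  assumes v: "\<And>k. 0 < v $ k" "\<And>x. v \<bullet> x = 0 \<Longrightarrow> lyap B x \<le> lam2"
  shows "(\<lambda>n. (\<Sum>i\<in>UNIV. fwd_prod B n $ i $ k) / (\<Sum>i\<in>UNIV. \<Sum>j\<in>UNIV. fwd_prod B n $ i $ j))
    \<longlonglongrightarrow> v $ k / (\<Sum>j\<in>UNIV. v $ j)"
proof -
  define q where "q = v $ k / (\<Sum>j\<in>UNIV. v $ j)"
  \<comment> \<open>The factor q makes y orthogonal to v, hence of slower growth. The coordinates of
    M_n y add up to the sum of column k minus q times the sum of all entries.\<close>
  define y where "y = axis k (1::real) - q *\<^sub>R (\<chi> j. 1)"
  have "0 < (\<Sum>j\<in>UNIV. v $ j)" using v(1) by (simp add: sum_pos)
  then have "v \<bullet> y = 0"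
    by (simp add: y_def q_def inner_diff_right inner_axis) (simp add: inner_vec_def)
  obtain b c where bc: "lam2 < ereal c" "c < b" "ereal b < lam1" by (rule gap_reals)
  have "lyap B y < ereal c"
    using v(2)[OF \<open>v \<bullet> y = 0\<close>] bc(1) by simp
  then have small: "\<forall>\<^sub>F n in sequentially. norm (fwd_prod B n *v y) \<le> exp (real n * c)"
    by (rule lyap_lessD)
  define col where "col n = (\<Sum>i\<in>UNIV. fwd_prod B n $ i $ k)" for n
  define tot where "tot n = (\<Sum>i\<in>UNIV. \<Sum>j\<in>UNIV. fwd_prod B n $ i $ j)" for n
  have "(\<lambda>n. col n / tot n - q) \<longlonglongrightarrow> 0"
  proof (rule tendsto_0_le)
    show "(\<lambda>n. exp (real n * (c - b))) \<longlonglongrightarrow> 0"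
      using bc(2) by real_asymp
    show "\<forall>\<^sub>F n in sequentially. norm (col n / tot n - q) \<le> norm (exp (real n * (c - b))) * real CARD('p)"
      using small growth[OF bc(3)]
    proof eventually_elim
      case (elim n)
      have "norm (fwd_prod B n) \<le> tot n"
        using norm_matrix_le_sum[of "fwd_prod B n"] by (simp add: tot_def entry_nonneg)
      with elim have tot: "exp (real n * b) < tot n" by linarith
      then have tot_pos: "0 < tot n" using exp_gt_zero[of "real n * b"] by linarith
      have "(fwd_prod B n *v y) $ i = fwd_prod B n $ i $ k - q * (\<Sum>j\<in>UNIV. fwd_prod B n $ i $ j)" for i
      proof -
        have "(fwd_prod B n *v axis k 1) $ i = fwd_prod B n $ i $ k"
          by (simp add: matrix_vector_mul_component inner_axis)
        moreover have "(fwd_prod B n *v (\<chi> j. 1)) $ i = (\<Sum>j\<in>UNIV. fwd_prod B n $ i $ j)"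
          by (simp add: matrix_vector_mult_def)
        ultimately show ?thesis
          by (simp add: y_def matrix_vector_mult_diff_distrib matrix_vector_mult_scaleR)
      qed
      then have "col n - q * tot n = (\<Sum>i\<in>UNIV. (fwd_prod B n *v y) $ i)"
        by (simp add: col_def tot_def sum_subtractf sum_distrib_left)
      also have "\<bar>\<dots>\<bar> \<le> (\<Sum>i\<in>(UNIV::'p set). norm (fwd_prod B n *v y))"
        by (intro order_trans[OF sum_abs] sum_mono component_le_norm_cart)
      also have "\<dots> \<le> real CARD('p) * exp (real n * c)"
        using elim(1) by simp
      finally have num: "\<bar>col n - q * tot n\<bar> \<le> real CARD('p) * exp (real n * c)" .
      have "norm (col n / tot n - q) = \<bar>col n - q * tot n\<bar> / tot n"
        using tot_pos by (simp add: abs_div_pos diff_divide_distrib)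
      also have "\<dots> \<le> real CARD('p) * exp (real n * c) / exp (real n * b)"
        using num tot by (intro frac_le) auto
      also have "\<dots> = norm (exp (real n * (c - b))) * real CARD('p)"
        by (simp add: exp_diff right_diff_distrib)
      finally show ?case .
    qed
  qed
  then have "(\<lambda>n. col n / tot n) \<longlonglongrightarrow> q" by (rule LIM_zero_cancel)
  then show ?thesis unfolding col_def tot_def q_def .
qed

text \<open>When an exponent is infinite the gap is \<infinity> and r is arbitrary; b and c are then
  placed with c - b = r - 1.\<close>

lemma gap_rate_reals:
  assumes "- (lam1 - lam2) < ereal r"
  obtains b c where "lam2 < ereal c" "ereal b < lam1" "c - b < r"
proof (cases lam1)
  case PInf
  obtain c where "lam2 < ereal c" using gap ereal_dense2 by blast
  then show ?thesis using that[of c "c - r + 1"] PInf by simp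
next
  case MInf
  then show ?thesis using gap by simp
next
  case (real l1)
  show ?thesis
  proof (cases lam2)
    case (real l2)
    \<comment> \<open>A third of the slack: c - b exceeds l2 - l1 by 2 d, while r exceeds it by 3
      d.\<close>
    define d where "d = (r - (l2 - l1)) / 3"
    have "0 < d" using assms real \<open>lam1 = ereal l1\<close> by (simp add: d_def)
    then show ?thesis
      using that[of "l2 + d" "l1 - d"] real \<open>lam1 = ereal l1\<close> by (simp add: d_def field_simps)
  next
    case PInf
    then show ?thesis using gap by simp
  next
    case MInf
    then show ?thesis using that[of "l1 + r - 2" "l1 - 1"] real by simp
  qed
qed

lemma node_ratio_rate:
  assumes v: "\<And>k. 0 < v $ k" "\<And>x. v \<bullet> x = 0 \<Longrightarrow> lyap B x \<le> lam2"
    and ratio: "\<And>\<epsilon> j k. 0 < \<epsilon> \<Longrightarrow> \<forall>\<^sub>F n in sequentially.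
      fwd_prod B n $ j $ k \<le> exp (\<epsilon> * real n) * fwd_prod B n $ i $ k \<or> fwd_prod B n $ i $ k = 0"
    and w: "\<And>k. 0 \<le> w $ k" "w \<noteq> 0"
    and r: "- (lam1 - lam2) < ereal r"
  shows "\<forall>\<^sub>F n in nonzero_row_indices B i.
    \<bar>node_ratio B x w i n - (v \<bullet> x) / (v \<bullet> w)\<bar> \<le> exp (real n * r)"
proof -
  obtain l where l: "0 < w $ l"
    using w by (metis less_eq_real_def vec_eq_iff zero_index)
  have "0 < (\<Sum>k\<in>UNIV. v $ k * w $ k)"
    by (rule sum_pos2[of UNIV l]) (use v(1) l w in \<open>auto simp: less_imp_le\<close>)
  then have vw: "0 < v \<bullet> w" by (simp add: inner_vec_def)
  define q where "q = (v \<bullet> x) / (v \<bullet> w)"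
  define y where "y = x - q *\<^sub>R w"
  have "v \<bullet> y = 0" using vw by (simp add: y_def q_def inner_diff_right)
  obtain b c where bc: "lam2 < ereal c" "ereal b < lam1" "c - b < r"
    using r by (rule gap_rate_reals)
  \<comment> \<open>One half of the slack pays for the subexponential entry ratios, the other
    absorbs the factor p * p * K.\<close>
  define e where "e = (r - (c - b)) / 2"
  have e: "0 < e" using bc(3) by (simp add: e_def)
  have "lyap B y < ereal c"
    using v(2)[OF \<open>v \<bullet> y = 0\<close>] bc(1) by simp
  then have small: "\<forall>\<^sub>F n in sequentially. norm (fwd_prod B n *v y) \<le> exp (real n * c)"
    by (rule lyap_lessD)
  obtain K where K: "0 < K"
    "\<forall>\<^sub>F n in sequentially. \<forall>i k. fwd_prod B n $ i $ k \<le> K * (fwd_prod B n *v w) $ i"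
    using w by (rule eventually_entry_le)
  \<comment> \<open>Taking unit vectors as weights compares the entries within a row: at large times
    a nonzero row has no zero entry. This excludes the second alternative in
    \<open>ratio\<close>.\<close>
  have "\<exists>K. \<forall>\<^sub>F n in sequentially. \<forall>i j. fwd_prod B n $ i $ j \<le> K * fwd_prod B n $ i $ k" for k
  proof -
    have column: "(fwd_prod B n *v axis k 1) $ i = fwd_prod B n $ i $ k" for n i
      by (simp add: matrix_vector_mul_component inner_axis)
    have "0 \<le> axis k (1::real) $ j" for j by (simp add: axis_def)
    moreover have "axis k (1::real) \<noteq> 0" by (simp add: axis_eq_0_iff)
    ultimately obtain K where "0 < K" "\<forall>\<^sub>F n in sequentially. \<forall>i j.
        fwd_prod B n $ i $ j \<le> K * (fwd_prod B n *v axis k 1) $ i"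
      by (rule eventually_entry_le)
    then show ?thesis unfolding column by blast
  qed
  then obtain K' where K':
    "\<And>k. \<forall>\<^sub>F n in sequentially. \<forall>i j. fwd_prod B n $ i $ j \<le> K' k * fwd_prod B n $ i $ k"
    by moura
  have "\<forall>\<^sub>F n in sequentially. \<forall>k. \<forall>i j. fwd_prod B n $ i $ j \<le> K' k * fwd_prod B n $ i $ k"
    by (rule eventually_all_finite) (rule K')
  moreover have "\<forall>\<^sub>F n in sequentially. \<forall>j k.
      fwd_prod B n $ j $ k \<le> exp (e * real n) * fwd_prod B n $ i $ k \<or> fwd_prod B n $ i $ k = 0"
    by (intro eventually_all_finite) (rule ratio[OF e])
  moreover define p where "p = real CARD('p)"
  moreover have "\<forall>\<^sub>F n in sequentially. (p * (p * K)) * exp (real n * (c - b + e)) \<le> exp (real n * r)"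
    by (rule eventually_const_mult_exp_le) (use bc(3) in \<open>simp add: e_def field_simps\<close>)
  ultimately have "\<forall>\<^sub>F n in sequentially. row i (fwd_prod B n) \<noteq> 0 \<longrightarrow>
      \<bar>node_ratio B x w i n - q\<bar> \<le> exp (real n * r)"
    using small K(2) growth[OF bc(2)]
  proof eventually_elim
    case (elim n)
    from elim(7) obtain j where j: "fwd_prod B n $ i $ j \<noteq> 0"
      by (auto simp: row_def vec_eq_iff)
    then have j_pos: "0 < fwd_prod B n $ i $ j"
      using entry_nonneg[of n i j] by linarith
    have nz: "fwd_prod B n $ i $ k \<noteq> 0" for k
    proof
      assume "fwd_prod B n $ i $ k = 0"
      with elim(1) have "fwd_prod B n $ i $ j \<le> 0" by (metis mult_zero_right)
      with j_pos show False by simp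
    qed
    define z where "z = (fwd_prod B n *v w) $ i"
    \<comment> \<open>Lower bound for the denominator z: each entry is moved within its column to
      row i at the cost exp (e n), and entries of row i are at most K z. Hence the norm, which grows
      at least at rate b, is at most a constant times exp (e n) z.\<close>
    have "norm (fwd_prod B n) \<le> (\<Sum>j\<in>UNIV. \<Sum>k\<in>UNIV. \<bar>fwd_prod B n $ j $ k\<bar>)"
      by (rule norm_matrix_le_sum)
    also have "\<dots> \<le> (\<Sum>j\<in>(UNIV::'p set). \<Sum>k\<in>(UNIV::'p set). exp (e * real n) * (K * z))"
    proof (intro sum_mono)
      fix j k
      have "\<bar>fwd_prod B n $ j $ k\<bar> \<le> exp (e * real n) * fwd_prod B n $ i $ k"
        using elim(2) nz entry_nonneg[of n j k] by auto
      also have "\<dots> \<le> exp (e * real n) * (K * z)"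
        using elim(5) by (simp add: z_def)
      finally show "\<bar>fwd_prod B n $ j $ k\<bar> \<le> exp (e * real n) * (K * z)" .
    qed
    also have "\<dots> = p * (p * K) * exp (real n * e) * z"
      by (simp add: p_def mult_ac)
    finally have z: "exp (real n * b) \<le> p * (p * K) * exp (real n * e) * z"
      using elim(6) by linarith
    have pK: "0 < p * (p * K)"
      using K(1) by (simp add: p_def)
    have z_pos: "0 < z"
      using z pK exp_gt_zero[of "real n * b"]
      by (metis exp_gt_zero less_le_trans mult_pos_pos zero_less_mult_pos)
    have "(fwd_prod B n *v y) $ i = (fwd_prod B n *v x) $ i - q * z"
      by (simp add: y_def z_def matrix_vector_mult_diff_distrib matrix_vector_mult_scaleR)
    then have "node_ratio B x w i n - q = (fwd_prod B n *v y) $ i / z"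
      using z_pos by (simp add: node_ratio_def diff_divide_distrib flip: z_def)
    then have "\<bar>node_ratio B x w i n - q\<bar> = \<bar>(fwd_prod B n *v y) $ i\<bar> / z"
      using z_pos by simp
    also have "\<dots> \<le> exp (real n * c) / z"
      using elim(4) component_le_norm_cart[of "fwd_prod B n *v y" i] z_pos
      by (intro divide_right_mono) auto
    also have "\<dots> \<le> p * (p * K) * exp (real n * (c - b + e))"
    proof -
      have "exp (real n * c) = exp (real n * b) * exp (real n * (c - b))"
        by (simp add: exp_add[symmetric] algebra_simps)
      also have "\<dots> \<le> (p * (p * K) * exp (real n * e) * z) * exp (real n * (c - b))"
        using z by (intro mult_right_mono) auto
      also have "\<dots> = (p * (p * K) * exp (real n * (c - b + e))) * z"
        by (simp add: exp_add ring_distribs mult_ac)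
      finally show ?thesis using z_pos by (simp add: divide_le_eq)
    qed
    also have "\<dots> \<le> exp (real n * r)" using elim(3) .
    finally show ?case .
  qed
  then show ?thesis
    unfolding nonzero_row_indices_def eventually_inf_principal q_def by simp
qed

text \<open>The gap is positive, so some negative r is admissible, which gives convergence. The rate
  follows by taking all admissible r.\<close>

lemma node_ratio_limit:
  assumes v: "\<And>k. 0 < v $ k" "\<And>x. v \<bullet> x = 0 \<Longrightarrow> lyap B x \<le> lam2"
    and ratio: "\<And>\<epsilon> j k. 0 < \<epsilon> \<Longrightarrow> \<forall>\<^sub>F n in sequentially.
      fwd_prod B n $ j $ k \<le> exp (\<epsilon> * real n) * fwd_prod B n $ i $ k \<or> fwd_prod B n $ i $ k = 0"
    and w: "\<And>k. 0 \<le> w $ k" "w \<noteq> 0"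
  shows "(node_ratio B x w i \<longlongrightarrow> (v \<bullet> x) / (v \<bullet> w)) (nonzero_row_indices B i)" (is ?lim)
    and "Limsup (nonzero_row_indices B i)
      (\<lambda>n. ereal (1 / real n) * log_ereal \<bar>node_ratio B x w i n - (v \<bullet> x) / (v \<bullet> w)\<bar>)
      \<le> - (lam1 - lam2)" (is "?L \<le> _")
proof -
  have F: "nonzero_row_indices B i \<le> sequentially"
    by (simp add: nonzero_row_indices_def)
  have rate: "\<forall>\<^sub>F n in nonzero_row_indices B i.
      \<bar>node_ratio B x w i n - (v \<bullet> x) / (v \<bullet> w)\<bar> \<le> exp (real n * r)"
    if "- (lam1 - lam2) < ereal r" for r
    using v ratio w that by (rule node_ratio_rate)
  have "- (lam1 - lam2) < 0"
    using gap by (cases lam1; cases lam2) auto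
  then obtain r where r: "- (lam1 - lam2) < ereal r" "ereal r < 0"
    using ereal_dense2 by blast
  then have "(\<lambda>n. exp (real n * r)) \<longlonglongrightarrow> 0"
    by simp real_asymp
  then have "((\<lambda>n. exp (real n * r)) \<longlongrightarrow> 0) (nonzero_row_indices B i)"
    by (rule tendsto_mono[OF F])
  moreover have "\<forall>\<^sub>F n in nonzero_row_indices B i.
      norm (node_ratio B x w i n - (v \<bullet> x) / (v \<bullet> w)) \<le> norm (exp (real n * r)) * 1"
    using rate[OF r(1)] by simp
  ultimately have "((\<lambda>n. node_ratio B x w i n - (v \<bullet> x) / (v \<bullet> w)) \<longlongrightarrow> 0) (nonzero_row_indices B i)"
    by (rule tendsto_0_le)
  then show ?lim by (rule LIM_zero_cancel)
  have le: "?L \<le> ereal r" if "- (lam1 - lam2) < ereal r" for r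
    by (rule Limsup_scaled_log_le[OF F]) (use rate[OF that] in auto)
  show "?L \<le> - (lam1 - lam2)"
  proof (rule ccontr)
    assume "\<not> ?L \<le> - (lam1 - lam2)"
    then obtain r where "- (lam1 - lam2) < ereal r" "ereal r < ?L"
      using ereal_dense2[of "- (lam1 - lam2)" ?L] by (auto simp: not_le)
    with le[of r] show False by simp
  qed
qed

end

section \<open>From the almost sure hypotheses to single realizations\<close>

lemma AE_fwd_prod_growth:
  fixes A :: "nat \<Rightarrow> 'w \<Rightarrow> real^'p^'p" and lam1 :: ereal
  assumes "prob_space P"
    and "\<And>n. 1 \<le> n \<Longrightarrow> A n \<in> borel_measurable P"
    and "strictly_stationary P A" and "ergodic_process P A"
    and "integrable P (\<lambda>\<omega>. ln (max 1 (norm (A 1 \<omega>))))"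
    and lam1: "has_lyap_exponent P A 1 lam1" and b: "ereal b < lam1"
  shows "AE \<omega> in P. \<forall>\<^sub>F n in sequentially. exp (real n * b) < norm (fwd_prod (realization A \<omega>) n)"
proof -
  interpret prob_space P by fact
  obtain c where c: "ereal b < ereal c" "ereal c < lam1"
    using ereal_dense2[OF b] by blast
  have "lam1 \<noteq> -\<infinity>" using b by auto
  \<comment> \<open>Since lam1 differs from the default -\<infinity>, it is the growth rate of an
    actual vector. Norms of the products bounded by exp (n c) with c < lam1 would force a smaller
    rate on it.\<close>
  have "\<not> (AE \<omega> in P. \<forall>\<^sub>F n in sequentially. norm (fwd_prod (realization A \<omega>) n) \<le> exp (real n * c))"
  proof
    assume "AE \<omega> in P. \<forall>\<^sub>F n in sequentially. norm (fwd_prod (realization A \<omega>) n) \<le> exp (real n * c)"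
    then have "AE \<omega> in P. False"
      using lam1[unfolded has_lyap_exponent_def]
    proof eventually_elim
      case (elim \<omega>)
      let ?B = "realization A \<omega>"
      have "lam1 \<in> lyap_values ?B"
        using lyap_exponent_in_values[of ?B 1] elim(2) \<open>lam1 \<noteq> -\<infinity>\<close> by simp
      then obtain x where x: "lyap ?B x = lam1"
        by (auto simp: lyap_values_def)
      have "\<forall>\<^sub>F n in sequentially. norm (fwd_prod ?B n *v x) \<le> norm x * exp (real n * c)"
        using elim(1)
      proof eventually_elim
        case (elim n)
        have "norm (fwd_prod ?B n *v x) \<le> norm (fwd_prod ?B n) * norm x"
          by (rule norm_matrix_vector_mult_le)
        also have "\<dots> \<le> exp (real n * c) * norm x"
          using elim by (rule mult_right_mono) simp
        finally show ?case by (simp add: mult.commute)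
      qed
      then have "lyap ?B x < lam1" using c(2) by (rule lyap_lessI)
      with x show ?case by simp
    qed
    then show False by simp
  qed
  then show ?thesis
    using fwd_prod_norm_dichotomy[OF assms(1-5), of "c - b" b] c(1) by auto
qed

lemma entry_le_if_entry_ratio_bounded:
  assumes "0 \<le> fwd_prod (realization A \<omega>) n $ i $ k" "0 \<le> fwd_prod (realization A \<omega>) n $ j $ k"
    and "\<bar>entry_ratio A j i k n \<omega>\<bar> \<le> ereal c \<or> entry_ratio A j i k n \<omega> = \<infinity>"
  shows "fwd_prod (realization A \<omega>) n $ j $ k \<le> c * fwd_prod (realization A \<omega>) n $ i $ k
    \<or> fwd_prod (realization A \<omega>) n $ i $ k = 0"
proof (cases "fwd_prod (realization A \<omega>) n $ i $ k = 0")
  case False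
  then have "entry_ratio A j i k n \<omega>
      = ereal (fwd_prod (realization A \<omega>) n $ j $ k / fwd_prod (realization A \<omega>) n $ i $ k)"
    by (simp add: entry_ratio_def)
  with False assms show ?thesis by (auto simp: divide_simps)
qed simp

text \<open>The quantifier over \<epsilon> moves inside the almost sure statement by way of the
  sequence 1 / (m + 1).\<close>

lemma AE_entry_le:
  fixes A :: "nat \<Rightarrow> 'w \<Rightarrow> real^'p^'p"
  assumes nonneg: "AE \<omega> in P. \<forall>n\<ge>1. nonneg_matrix (A n \<omega>)"
    and "\<And>i j k. weakly_subexponential P (entry_ratio A i j k)"
  shows "AE \<omega> in P. \<forall>\<epsilon>>0. \<forall>i j k. \<forall>\<^sub>F n in sequentially.
    fwd_prod (realization A \<omega>) n $ j $ k \<le> exp (\<epsilon> * real n) * fwd_prod (realization A \<omega>) n $ i $ k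
    \<or> fwd_prod (realization A \<omega>) n $ i $ k = 0"
proof -
  define d where "d m = inverse (real (Suc m))" for m
  have "AE \<omega> in P. \<forall>m i j k. \<forall>\<^sub>F n in sequentially.
      \<bar>entry_ratio A j i k n \<omega>\<bar> \<le> ereal (exp (d m * real n)) \<or> entry_ratio A j i k n \<omega> = \<infinity>"
    unfolding AE_all_countable
    using assms(2) unfolding weakly_subexponential_def d_def by simp
  with nonneg show ?thesis
  proof eventually_elim
    case (elim \<omega>)
    have entry: "0 \<le> fwd_prod (realization A \<omega>) n $ i $ k" for n i k
      using elim(1) by (intro fwd_prod_nonneg) (simp add: realization_def)
    show ?case
    proof (intro allI impI)
      fix \<epsilon> :: real and i j k assume "0 < \<epsilon>"
      then obtain m where m: "d m < \<epsilon>" using reals_Archimedean by (auto simp: d_def)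
      show "\<forall>\<^sub>F n in sequentially.
          fwd_prod (realization A \<omega>) n $ j $ k \<le> exp (\<epsilon> * real n) * fwd_prod (realization A \<omega>) n $ i $ k
          \<or> fwd_prod (realization A \<omega>) n $ i $ k = 0"
        using elim(2)[rule_format, of j i k m]
      proof eventually_elim
        case (elim n)
        then have "fwd_prod (realization A \<omega>) n $ j $ k
            \<le> exp (d m * real n) * fwd_prod (realization A \<omega>) n $ i $ k
            \<or> fwd_prod (realization A \<omega>) n $ i $ k = 0"
          using entry by (intro entry_le_if_entry_ratio_bounded)
        moreover have "exp (d m * real n) * fwd_prod (realization A \<omega>) n $ i $ k
            \<le> exp (\<epsilon> * real n) * fwd_prod (realization A \<omega>) n $ i $ k"
          using m entry by (intro mult_right_mono) (auto intro: mult_right_mono)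
        ultimately show ?case by linarith
      qed
    qed
  qed
qed

theorem theorem1p9:
  fixes P :: "'w measure"
    and A :: "nat \<Rightarrow> 'w \<Rightarrow> real^'p^'p"
    and lam1 lam2 :: ereal
  assumes "prob_space P"
    and "\<And>n. 1 \<le> n \<Longrightarrow> A n \<in> borel_measurable P"
    and "strictly_stationary P A"
    and "ergodic_process P A"
    and "\<And>n. 1 \<le> n \<Longrightarrow> AE \<omega> in P. nonneg_matrix (A n \<omega>) \<and> column_allowable (A n \<omega>)"
    and "weakly_seq_primitive P A"
    and "integrable P (\<lambda>\<omega>. ln (max 1 (norm (A 1 \<omega>))))"
    and "has_lyap_exponent P A 1 lam1"
    and "has_lyap_exponent P A 2 lam2"
    and "lam2 < lam1"
    and "\<And>i j k. weakly_subexponential P (entry_ratio A i j k)"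
  shows "\<exists>v :: 'w \<Rightarrow> real^'p.
    v \<in> borel_measurable P \<and>
    (AE \<omega> in P. \<forall>k. 0 < v \<omega> $ k) \<and>
    (\<forall>x w :: real^'p. (\<forall>k. 0 \<le> w $ k) \<and> w \<noteq> 0 \<longrightarrow>
      ratio_consensus P A x w (\<lambda>\<omega>. (v \<omega> \<bullet> x) / (v \<omega> \<bullet> w)) \<and>
      (\<forall>i. AE \<omega> in P.
        Limsup (nonzero_row_indices (realization A \<omega>) i)
          (\<lambda>n. ereal (1 / real n) *
            log_ereal \<bar>node_ratio (realization A \<omega>) x w i n - (v \<omega> \<bullet> x) / (v \<omega> \<bullet> w)\<bar>)
        \<le> - (lam1 - lam2)))"
proof -
  define M where "M \<omega> n = fwd_prod (realization A \<omega>) n" for \<omega> n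
  \<comment> \<open>Involves neither \<open>x\<close> nor \<open>w\<close>, and is measurable as a
    limit of measurable functions whether or not the limit exists at every point.\<close>
  define v :: "'w \<Rightarrow> real^'p" where
    "v \<omega> = (\<chi> k. lim (\<lambda>n. (\<Sum>i\<in>UNIV. M \<omega> n $ i $ k) / (\<Sum>i\<in>UNIV. \<Sum>j\<in>UNIV. M \<omega> n $ i $ j)))" for \<omega>
  have [measurable]: "(\<lambda>\<omega>. M \<omega> n $ i $ k) \<in> borel_measurable P" for n i k
  proof -
    have "(\<lambda>\<omega>. M \<omega> n) \<in> borel_measurable P"
      unfolding M_def using assms(2) by (rule fwd_prod_measurable)
    moreover have "(\<lambda>Z. Z $ i $ k) \<in> borel_measurable (borel :: (real^'p^'p) measure)"
      by (intro borel_measurable_continuous_onI continuous_intros)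
    ultimately show ?thesis by (rule measurable_compose)
  qed
  have v_meas: "v \<in> borel_measurable P"
  proof (subst borel_measurable_euclidean_space, intro ballI)
    fix b :: "real^'p" assume "b \<in> Basis"
    then obtain k where "b = axis k 1" by (auto simp: Basis_vec_def)
    then have "(\<lambda>\<omega>. v \<omega> \<bullet> b)
        = (\<lambda>\<omega>. lim (\<lambda>n. (\<Sum>i\<in>UNIV. M \<omega> n $ i $ k) / (\<Sum>i\<in>UNIV. \<Sum>j\<in>UNIV. M \<omega> n $ i $ j)))"
      by (simp add: v_def inner_axis)
    also have "\<dots> \<in> borel_measurable P" by measurable
    finally show "(\<lambda>\<omega>. v \<omega> \<bullet> b) \<in> borel_measurable P" .
  qed
  have nonneg: "AE \<omega> in P. \<forall>n\<ge>1. nonneg_matrix (A n \<omega>)"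
    unfolding AE_all_countable using assms(5) by auto
  have rows: "AE \<omega> in P. \<exists>m. \<forall>i. (\<forall>k. 0 < M \<omega> m $ i $ k) \<or> (\<forall>k. M \<omega> m $ i $ k = 0)"
  proof -
    obtain \<tau> where "AE \<omega> in P. \<exists>n. \<tau> \<omega> = enat n \<and>
        (\<forall>i. (\<forall>k. 0 < M \<omega> n $ i $ k) \<or> (\<forall>k. M \<omega> n $ i $ k = 0))"
      using assms(6) unfolding weakly_seq_primitive_def M_def by blast
    then show ?thesis by eventually_elim blast
  qed
  have growth: "AE \<omega> in P. \<forall>q::rat. ereal (real_of_rat q) < lam1 \<longrightarrow>
      (\<forall>\<^sub>F n in sequentially. exp (real n * real_of_rat q) < norm (M \<omega> n))"
    unfolding AE_all_countable
  proof
    fix q :: rat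
    show "AE \<omega> in P. ereal (real_of_rat q) < lam1 \<longrightarrow>
        (\<forall>\<^sub>F n in sequentially. exp (real n * real_of_rat q) < norm (M \<omega> n))"
    proof (cases "ereal (real_of_rat q) < lam1")
      case True
      from AE_fwd_prod_growth[OF assms(1-4,7,8) True] show ?thesis
        by (simp add: M_def True)
    qed simp
  qed
  have good: "AE \<omega> in P. positive_product (realization A \<omega>) lam1 lam2"
    using nonneg rows growth assms(8,9)[unfolded has_lyap_exponent_def]
  proof eventually_elim
    case (elim \<omega>)
    show ?case
    proof
      show "nonneg_matrix (realization A \<omega> n)" if "1 \<le> n" for n
        using elim(1) that by (simp add: realization_def)
      fix b assume "ereal b < lam1"
      then obtain q where q: "ereal b < ereal (real_of_rat q)" "ereal (real_of_rat q) < lam1"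
        using ereal_dense3[of "ereal b" lam1] by auto
      then have "\<forall>\<^sub>F n in sequentially. exp (real n * real_of_rat q) < norm (M \<omega> n)"
        using elim(3) by blast
      then show "\<forall>\<^sub>F n in sequentially. exp (real n * b) < norm (fwd_prod (realization A \<omega>) n)"
      proof eventually_elim
        case (elim n)
        have "exp (real n * b) \<le> exp (real n * real_of_rat q)"
          using q(1) by (auto intro: mult_left_mono)
        with elim show ?case unfolding M_def by linarith
      qed
    qed (use elim assms(10) in \<open>auto simp: M_def\<close>)
  qed
  have normal: "AE \<omega> in P. (\<forall>k. 0 < v \<omega> $ k) \<and>
      (\<forall>x. v \<omega> \<bullet> x = 0 \<longrightarrow> lyap (realization A \<omega>) x \<le> lam2)"
    using good
  proof eventually_elim
    case (elim \<omega>)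
    interpret positive_product "realization A \<omega>" lam1 lam2 by (rule elim)
    obtain u where u: "\<And>k. 0 < u $ k" "\<And>x. u \<bullet> x = 0 \<Longrightarrow> lyap (realization A \<omega>) x \<le> lam2"
      by (rule positive_normal) blast
    define s where "s = (\<Sum>j\<in>UNIV. u $ j)"
    have s: "0 < s" unfolding s_def using u(1) by (simp add: sum_pos)
    \<comment> \<open>Being a positive multiple of u, it inherits positivity and has the same
      orthogonal hyperplane.\<close>
    have "v \<omega> = (1 / s) *\<^sub>R u"
      unfolding v_def M_def s_def vec_eq_iff
      using limI[OF column_sum_ratio_tendsto[of u]] u by simp
    then show ?case using s u by simp
  qed
  have entries: "AE \<omega> in P. \<forall>\<epsilon>>0. \<forall>i j k. \<forall>\<^sub>F n in sequentially.
      fwd_prod (realization A \<omega>) n $ j $ k \<le> exp (\<epsilon> * real n) * fwd_prod (realization A \<omega>) n $ i $ k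
      \<or> fwd_prod (realization A \<omega>) n $ i $ k = 0"
    using nonneg assms(11) by (rule AE_entry_le)
  show ?thesis
  proof (intro exI[of _ v] conjI allI impI)
    show "v \<in> borel_measurable P" by (rule v_meas)
    show "AE \<omega> in P. \<forall>k. 0 < v \<omega> $ k"
      using normal by eventually_elim simp
  next
    fix x w :: "real^'p" assume w: "(\<forall>k. 0 \<le> w $ k) \<and> w \<noteq> 0"
    show "ratio_consensus P A x w (\<lambda>\<omega>. (v \<omega> \<bullet> x) / (v \<omega> \<bullet> w))"
      unfolding ratio_consensus_def
    proof
      fix i
      show "AE \<omega> in P. (node_ratio (realization A \<omega>) x w i \<longlongrightarrow> (v \<omega> \<bullet> x) / (v \<omega> \<bullet> w))
          (nonzero_row_indices (realization A \<omega>) i)"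
        using good normal entries
        by eventually_elim (rule positive_product.node_ratio_limit(1), use w in auto)
    qed
    fix i
    show "AE \<omega> in P. Limsup (nonzero_row_indices (realization A \<omega>) i)
          (\<lambda>n. ereal (1 / real n) *
            log_ereal \<bar>node_ratio (realization A \<omega>) x w i n - (v \<omega> \<bullet> x) / (v \<omega> \<bullet> w)\<bar>)
        \<le> - (lam1 - lam2)"
      using good normal entries
      by eventually_elim (rule positive_product.node_ratio_limit(2), use w in auto)
  qed
qed

end
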